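(* Let $(A,s)$ and $(X,t)$ be monads in a bicategory $\mathcal{K}$, let $f:X\to A$ be a map in $\mathcal{K}$ with right adjoint $f^{\star}:A\to X$, and let $(u,f^{\star},\pi)$ be an adjunction core between $(A,s)$ and $(X,t)$, i.e. $u:A\to X$ is a morphism and $\pi:f^{\star}s\to tu$ is an invertible 2-cell in $\mathcal{K}$. Write $g=f^{\star}$ and define $$\bar\beta=\pi\cdot g\eta:g\to tu,\qquad \bar\alpha=\pi^{-1}\cdot\eta u:u\to gs,$$ $$\upsilon=\pi\cdot g\mu\cdot\bar\alpha s:us\to tu,\qquad \psi=\pi^{-1}\cdot\mu u\cdot t\bar\beta:tg\to gs.$$ Then the core extends to an adjunction $(f,\phi)\dashv(u,\upsilon):(A,s)\to(X,t)$ in $\mathrm{KL}(\mathcal{K})$ if and only if at least one of the following two conditions holds: (I) $\ \mu u\cdot t\upsilon\cdot\pi s=\pi\cdot g\mu:\ gss\to tu$; (II) $\ g\mu\cdot\psi s\cdot t\pi^{-1}=\pi^{-1}\cdot\mu u:\ ttu\to gs$. The adjunction is unique when it exists.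
   Context: Associativity and unit constraints of $\mathcal{K}$ are suppressed (one writes as if $\mathcal{K}$ were a 2-category); juxtaposition is horizontal composition ($gf$ means $f$ first) and $\cdot$ is vertical composition. A map in a bicategory is a morphism having a right adjoint; for a map $f$ one chooses a right adjoint $f^{\star}$ with unit $\eta_f:1_X\to f^{\star}f$ and counit $\varepsilon_f:ff^{\star}\to1_A$. A monad $(A,s)$ in $\mathcal{K}$ is an object $A$ with a morphism $s:A\to A$ and 2-cells $\eta:1_A\to s$, $\mu:ss\to s$ satisfying associativity and unit laws; $\eta,\mu$ denote the unit and multiplication of every monad. A monad opmorphism $(f,\phi):(A,s)\to(A',s')$ is a morphism $f:A\to A'$ with a 2-cell $\phi:fs\to s'f$ such that $\mu f\cdot s'\phi\cdot\phi s=\phi\cdot f\mu$ and $\phi\cdot f\eta=\eta f$. The composite of $(f,\phi)$ with $(f',\phi'):(A',s')\to(A'',s'')$ is $(f'f,\ \phi'f\cdot f'\phi)$. The bicategory $\mathrm{KL}(\mathcal{K})$ has monads in $\mathcal{K}$ as objects and monad opmorphisms as morphisms. A 2-cell $\rho:(f,\phi)\to(g,\psi):(A,s)\to(A',s')$ is a 2-cell $\rho:f\to s'g$ in $\mathcal{K}$ with $\mu g\cdot s'\rho\cdot\phi=\mu g\cdot s'\psi\cdot\rho s$. The vertical composite of $\rho:(f,\phi)\to(g,\psi)$ and $\tau:(g,\psi)\to(h,\theta)$ is $\mu h\cdot s'\tau\cdot\rho$; the identity on $(f,\phi)$ is $\eta f$; the horizontal composite of $\rho$ with $\rho':(f',\phi')\to(g',\psi'):(A',s')\to(A'',s'')$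 is $\mu g'g\cdot s''\rho'g\cdot\phi'g\cdot f'\rho$. Explicitly, an adjunction $(f,\phi)\dashv(u,\upsilon):(A,s)\to(X,t)$ in $\mathrm{KL}(\mathcal{K})$ with counit $\alpha$ and unit $\beta$ consists of monad opmorphisms $(u,\upsilon):(A,s)\to(X,t)$ (so $\upsilon:us\to tu$) and $(f,\phi):(X,t)\to(A,s)$ (so $\phi:ft\to sf$), and 2-cells $\alpha:fu\to s$ and $\beta:1_X\to tuf$ in $\mathcal{K}$ such that (1) $\mu\cdot\alpha s=\mu\cdot s\alpha\cdot\phi u\cdot f\upsilon$; (2) $\mu uf\cdot t\beta=\mu uf\cdot t\upsilon f\cdot tu\phi\cdot\beta t$; (3) $\eta f=\mu f\cdot s\alpha f\cdot\phi uf\cdot f\beta$; (4) $\eta u=\mu u\cdot t\upsilon\cdot tu\alpha\cdot\beta u$. When $f$ is a map, such an adjunction has an associated adjunction core $(u,f^{\star},\pi)$ with $\pi=\mu u\cdot t\upsilon\cdot tu\varepsilon_fs\cdot\beta f^{\star}s:f^{\star}s\to tu$ (which is invertible). A core $(u,f^{\star},\pi)$ extends to an adjunction if there is an adjunction in $\mathrm{KL}(\mathcal{K})$, with underlying morphisms $f$ and $u$, whose associated core is $(u,f^{\star},\pi)$; uniqueness means the data $\phi,\upsilon,\alpha,\beta$ are determined by the core. *)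

theory Defs
  imports Main
begin

section \<open>Bicategories\<close>

text \<open>
  Composites are written in applicative order: \<open>g \<star> f\<close> is first \<open>f\<close>, then \<open>g\<close>
  (juxtaposition \<open>gf\<close>), and \<open>\<beta> \<cdot> \<alpha>\<close> is first \<open>\<alpha>\<close>, then \<open>\<beta>\<close>.  The operations are total
  functions, constrained only on composable arguments from the carriers.  The constraint
  isomorphisms have the directions
  \<open>\<a>[h, g, f] : (h \<star> g) \<star> f \<Rightarrow> h \<star> (g \<star> f)\<close>, \<open>\<l>[f] : 1 \<star> f \<Rightarrow> f\<close> and \<open>\<r>[f] : f \<star> 1 \<Rightarrow> f\<close>.
\<close>

record ('o, 'm, 'c) bicat =
  Obj :: "'o set"
  Mor :: "'m set"
  Cell :: "'c set"
  src :: "'m \<Rightarrow> 'o"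
  trg :: "'m \<Rightarrow> 'o"
  vdom :: "'c \<Rightarrow> 'm"
  vcod :: "'c \<Rightarrow> 'm"
  one :: "'o \<Rightarrow> 'm"  ("\<one>\<index>")
  comp :: "'m \<Rightarrow> 'm \<Rightarrow> 'm"  (infixr "\<star>\<index>" 75)
  idc :: "'m \<Rightarrow> 'c"  ("\<i>\<index>")
  vcomp :: "'c \<Rightarrow> 'c \<Rightarrow> 'c"  (infixr "\<cdot>\<index>" 55)
  hcomp :: "'c \<Rightarrow> 'c \<Rightarrow> 'c"  (infixr "\<odot>\<index>" 65)
  asc :: "'m \<Rightarrow> 'm \<Rightarrow> 'm \<Rightarrow> 'c"  ("\<a>\<index>[_, _, _]")
  lunit :: "'m \<Rightarrow> 'c"  ("\<l>\<index>[_]")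
  runit :: "'m \<Rightarrow> 'c"  ("\<r>\<index>[_]")

context
  fixes K :: "('o, 'm, 'c) bicat" (structure)
begin

definition hom :: "'o \<Rightarrow> 'o \<Rightarrow> 'm set" where
  "hom A B = {f \<in> Mor K. src K f = A \<and> trg K f = B}"

definition cells :: "'m \<Rightarrow> 'm \<Rightarrow> 'c set" where
  "cells f g = {\<alpha> \<in> Cell K. vdom K \<alpha> = f \<and> vcod K \<alpha> = g}"

definition is_inverse :: "'c \<Rightarrow> 'c \<Rightarrow> bool" where
  "is_inverse \<alpha> \<beta> \<longleftrightarrow>
     \<alpha> \<in> Cell K \<and> \<beta> \<in> cells (vcod K \<alpha>) (vdom K \<alpha>) \<and>
     \<beta> \<cdot> \<alpha> = \<i> (vdom K \<alpha>) \<and> \<alpha> \<cdot> \<beta> = \<i> (vcod K \<alpha>)"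

definition invertible :: "'c \<Rightarrow> bool" where
  "invertible \<alpha> \<longleftrightarrow> (\<exists>\<beta>. is_inverse \<alpha> \<beta>)"

definition inv_cell :: "'c \<Rightarrow> 'c" where
  "inv_cell \<alpha> = (THE \<beta>. is_inverse \<alpha> \<beta>)"

end

abbreviation whisker_left :: "('o, 'm, 'c) bicat \<Rightarrow> 'm \<Rightarrow> 'c \<Rightarrow> 'c"  (infixr "\<rhd>\<index>" 66) where
  "f \<rhd>\<^bsub>K\<^esub> \<alpha> \<equiv> \<i>\<^bsub>K\<^esub> f \<odot>\<^bsub>K\<^esub> \<alpha>"

abbreviation whisker_right :: "('o, 'm, 'c) bicat \<Rightarrow> 'c \<Rightarrow> 'm \<Rightarrow> 'c"  (infixl "\<lhd>\<index>" 66) where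
  "\<alpha> \<lhd>\<^bsub>K\<^esub> f \<equiv> \<alpha> \<odot>\<^bsub>K\<^esub> \<i>\<^bsub>K\<^esub> f"

abbreviation asc_inv :: "('o, 'm, 'c) bicat \<Rightarrow> 'm \<Rightarrow> 'm \<Rightarrow> 'm \<Rightarrow> 'c"  ("\<a>\<^sup>-\<index>[_, _, _]") where
  "\<a>\<^sup>-\<^bsub>K\<^esub>[h, g, f] \<equiv> inv_cell K \<a>\<^bsub>K\<^esub>[h, g, f]"

abbreviation lunit_inv :: "('o, 'm, 'c) bicat \<Rightarrow> 'm \<Rightarrow> 'c"  ("\<l>\<^sup>-\<index>[_]") where
  "\<l>\<^sup>-\<^bsub>K\<^esub>[f] \<equiv> inv_cell K \<l>\<^bsub>K\<^esub>[f]"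

abbreviation runit_inv :: "('o, 'm, 'c) bicat \<Rightarrow> 'm \<Rightarrow> 'c"  ("\<r>\<^sup>-\<index>[_]") where
  "\<r>\<^sup>-\<^bsub>K\<^esub>[f] \<equiv> inv_cell K \<r>\<^bsub>K\<^esub>[f]"

locale bicategory =
  fixes K :: "('o, 'm, 'c) bicat" (structure)
  assumes mor_obj: "f \<in> Mor K \<Longrightarrow> src K f \<in> Obj K \<and> trg K f \<in> Obj K"
    and cell_mor: "\<alpha> \<in> Cell K \<Longrightarrow> vdom K \<alpha> \<in> Mor K \<and> vcod K \<alpha> \<in> Mor K"
    and cell_src: "\<alpha> \<in> Cell K \<Longrightarrow> src K (vdom K \<alpha>) = src K (vcod K \<alpha>)"
    and cell_trg: "\<alpha> \<in> Cell K \<Longrightarrow> trg K (vdom K \<alpha>) = trg K (vcod K \<alpha>)"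
    and one_hom: "A \<in> Obj K \<Longrightarrow> \<one> A \<in> hom K A A"
    and comp_hom: "f \<in> hom K A B \<Longrightarrow> g \<in> hom K B C \<Longrightarrow> g \<star> f \<in> hom K A C"
    and idc_cells: "f \<in> Mor K \<Longrightarrow> \<i> f \<in> cells K f f"
    and vcomp_cells: "\<alpha> \<in> cells K f g \<Longrightarrow> \<beta> \<in> cells K g h \<Longrightarrow> \<beta> \<cdot> \<alpha> \<in> cells K f h"
    and vcomp_idc: "\<alpha> \<in> cells K f g \<Longrightarrow> \<alpha> \<cdot> \<i> f = \<alpha>"
    and idc_vcomp: "\<alpha> \<in> cells K f g \<Longrightarrow> \<i> g \<cdot> \<alpha> = \<alpha>"
    and vcomp_assoc:
      "\<alpha> \<in> cells K f g \<Longrightarrow> \<beta> \<in> cells K g h \<Longrightarrow> \<gamma> \<in> cells K h k \<Longrightarrow>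
       (\<gamma> \<cdot> \<beta>) \<cdot> \<alpha> = \<gamma> \<cdot> (\<beta> \<cdot> \<alpha>)"
    and hcomp_cells:
      "\<alpha> \<in> cells K f f' \<Longrightarrow> \<beta> \<in> cells K g g' \<Longrightarrow> src K g = trg K f \<Longrightarrow>
       \<beta> \<odot> \<alpha> \<in> cells K (g \<star> f) (g' \<star> f')"
    and hcomp_idc:
      "f \<in> Mor K \<Longrightarrow> g \<in> Mor K \<Longrightarrow> src K g = trg K f \<Longrightarrow> \<i> g \<odot> \<i> f = \<i> (g \<star> f)"
    and interchange:
      "\<alpha> \<in> cells K f f' \<Longrightarrow> \<alpha>' \<in> cells K f' f'' \<Longrightarrow>
       \<beta> \<in> cells K g g' \<Longrightarrow> \<beta>' \<in> cells K g' g'' \<Longrightarrow> src K g = trg K f \<Longrightarrow>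
       (\<beta>' \<cdot> \<beta>) \<odot> (\<alpha>' \<cdot> \<alpha>) = (\<beta>' \<odot> \<alpha>') \<cdot> (\<beta> \<odot> \<alpha>)"
    and asc_cells:
      "f \<in> hom K A B \<Longrightarrow> g \<in> hom K B C \<Longrightarrow> h \<in> hom K C D \<Longrightarrow>
       \<a>[h, g, f] \<in> cells K ((h \<star> g) \<star> f) (h \<star> (g \<star> f))"
    and asc_invertible:
      "f \<in> hom K A B \<Longrightarrow> g \<in> hom K B C \<Longrightarrow> h \<in> hom K C D \<Longrightarrow> invertible K \<a>[h, g, f]"
    and asc_natural:
      "\<alpha> \<in> cells K f f' \<Longrightarrow> \<beta> \<in> cells K g g' \<Longrightarrow> \<gamma> \<in> cells K h h' \<Longrightarrow>
       src K g = trg K f \<Longrightarrow> src K h = trg K g \<Longrightarrow>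
       \<a>[h', g', f'] \<cdot> ((\<gamma> \<odot> \<beta>) \<odot> \<alpha>) = (\<gamma> \<odot> (\<beta> \<odot> \<alpha>)) \<cdot> \<a>[h, g, f]"
    and lunit_cells: "f \<in> hom K A B \<Longrightarrow> \<l>[f] \<in> cells K (\<one> B \<star> f) f"
    and lunit_invertible: "f \<in> Mor K \<Longrightarrow> invertible K \<l>[f]"
    and lunit_natural:
      "\<alpha> \<in> cells K f f' \<Longrightarrow> trg K f = B \<Longrightarrow> \<l>[f'] \<cdot> (\<one> B \<rhd> \<alpha>) = \<alpha> \<cdot> \<l>[f]"
    and runit_cells: "f \<in> hom K A B \<Longrightarrow> \<r>[f] \<in> cells K (f \<star> \<one> A) f"
    and runit_invertible: "f \<in> Mor K \<Longrightarrow> invertible K \<r>[f]"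
    and runit_natural:
      "\<alpha> \<in> cells K f f' \<Longrightarrow> src K f = A \<Longrightarrow> \<r>[f'] \<cdot> (\<alpha> \<lhd> \<one> A) = \<alpha> \<cdot> \<r>[f]"
    and triangle:
      "f \<in> hom K A B \<Longrightarrow> g \<in> hom K B C \<Longrightarrow> (g \<rhd> \<l>[f]) \<cdot> \<a>[g, \<one> B, f] = \<r>[g] \<lhd> f"
    and pentagon:
      "f \<in> hom K A B \<Longrightarrow> g \<in> hom K B C \<Longrightarrow> h \<in> hom K C D \<Longrightarrow> k \<in> hom K D E \<Longrightarrow>
       \<a>[k, h, g \<star> f] \<cdot> \<a>[k \<star> h, g, f] =
       (k \<rhd> \<a>[h, g, f]) \<cdot> \<a>[k, h \<star> g, f] \<cdot> (\<a>[k, h, g] \<lhd> f)"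


section \<open>Adjunctions, monads and monad opmorphisms\<close>

text \<open>
  From here on, a formula of the suppressed-constraint calculus is rendered by inserting the
  associativity and unit constraints between consecutive factors wherever their
  bracketings differ; by coherence the choice of inserted constraints is immaterial.  Iterated
  composites such as \<open>tuf\<close> are bracketed to the right unless shown otherwise.
\<close>

context
  fixes K :: "('o, 'm, 'c) bicat" (structure)
begin

text \<open>\<open>f \<stileturn> g\<close> with unit \<open>\<eta>\<close> and counit \<open>\<epsilon>\<close>, for \<open>f : X \<rightarrow> A\<close>.\<close>

definition adjunction :: "'o \<Rightarrow> 'o \<Rightarrow> 'm \<Rightarrow> 'm \<Rightarrow> 'c \<Rightarrow> 'c \<Rightarrow> bool" where
  "adjunction X A f g \<eta> \<epsilon> \<longleftrightarrow>
     f \<in> hom K X A \<and> g \<in> hom K A X \<and>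
     \<eta> \<in> cells K (\<one> X) (g \<star> f) \<and> \<epsilon> \<in> cells K (f \<star> g) (\<one> A) \<and>
     \<l>[f] \<cdot> (\<epsilon> \<lhd> f) \<cdot> \<a>\<^sup>-[f, g, f] \<cdot> (f \<rhd> \<eta>) \<cdot> \<r>\<^sup>-[f] = \<i> f \<and>
     \<r>[g] \<cdot> (g \<rhd> \<epsilon>) \<cdot> \<a>[g, f, g] \<cdot> (\<eta> \<lhd> g) \<cdot> \<l>\<^sup>-[g] = \<i> g"

definition monad :: "'o \<Rightarrow> 'm \<Rightarrow> 'c \<Rightarrow> 'c \<Rightarrow> bool" where
  "monad A s \<eta> \<mu> \<longleftrightarrow>
     A \<in> Obj K \<and> s \<in> hom K A A \<and> \<eta> \<in> cells K (\<one> A) s \<and> \<mu> \<in> cells K (s \<star> s) s \<and>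
     \<mu> \<cdot> (\<mu> \<lhd> s) = \<mu> \<cdot> (s \<rhd> \<mu>) \<cdot> \<a>[s, s, s] \<and>
     \<mu> \<cdot> (\<eta> \<lhd> s) = \<l>[s] \<and>
     \<mu> \<cdot> (s \<rhd> \<eta>) = \<r>[s]"

definition monad_opmorphism ::
  "'o \<Rightarrow> 'm \<Rightarrow> 'c \<Rightarrow> 'c \<Rightarrow> 'o \<Rightarrow> 'm \<Rightarrow> 'c \<Rightarrow> 'c \<Rightarrow> 'm \<Rightarrow> 'c \<Rightarrow> bool" where
  "monad_opmorphism A s \<eta> \<mu> A' s' \<eta>' \<mu>' f \<phi> \<longleftrightarrow>
     f \<in> hom K A A' \<and> \<phi> \<in> cells K (f \<star> s) (s' \<star> f) \<and>
     (\<mu>' \<lhd> f) \<cdot> \<a>\<^sup>-[s', s', f] \<cdot> (s' \<rhd> \<phi>) \<cdot> \<a>[s', f, s] \<cdot> (\<phi> \<lhd> s)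
       = \<phi> \<cdot> (f \<rhd> \<mu>) \<cdot> \<a>[f, s, s] \<and>
     \<phi> \<cdot> (f \<rhd> \<eta>) \<cdot> \<r>\<^sup>-[f] = (\<eta>' \<lhd> f) \<cdot> \<l>\<^sup>-[f]"

text \<open>
  Data of an adjunction \<open>(f, \<phi>) \<stileturn> (u, \<upsilon>) : (A, s) \<rightarrow> (X, t)\<close> in the bicategory \<open>KL(K)\<close> of
  monads, monad opmorphisms and Kleisli 2-cells, with counit \<open>\<alpha> : fu \<Rightarrow> s\<close> and unit
  \<open>\<beta> : 1 \<Rightarrow> tuf\<close>.  The four equations say in order that \<open>\<alpha>\<close> and \<open>\<beta>\<close> are 2-cells of \<open>KL(K)\<close>
  and that the two triangle identities hold there; without the constraints they read
    \<^item> \<open>\<mu> \<cdot> \<alpha>s = \<mu> \<cdot> s\<alpha> \<cdot> \<phi>u \<cdot> f\<upsilon>\<close>,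
    \<^item> \<open>\<mu>uf \<cdot> t\<beta> = \<mu>uf \<cdot> t\<upsilon>f \<cdot> tu\<phi> \<cdot> \<beta>t\<close>,
    \<^item> \<open>\<eta>f = \<mu>f \<cdot> s\<alpha>f \<cdot> \<phi>uf \<cdot> f\<beta>\<close>,
    \<^item> \<open>\<eta>u = \<mu>u \<cdot> t\<upsilon> \<cdot> tu\<alpha> \<cdot> \<beta>u\<close>.
\<close>

definition KL_adjunction ::
  "'o \<Rightarrow> 'm \<Rightarrow> 'c \<Rightarrow> 'c \<Rightarrow> 'o \<Rightarrow> 'm \<Rightarrow> 'c \<Rightarrow> 'c \<Rightarrow>
   'm \<Rightarrow> 'c \<Rightarrow> 'm \<Rightarrow> 'c \<Rightarrow> 'c \<Rightarrow> 'c \<Rightarrow> bool" where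
  "KL_adjunction A s \<eta>\<^sub>s \<mu>\<^sub>s X t \<eta>\<^sub>t \<mu>\<^sub>t f \<phi> u \<upsilon> \<alpha> \<beta> \<longleftrightarrow>
     monad_opmorphism A s \<eta>\<^sub>s \<mu>\<^sub>s X t \<eta>\<^sub>t \<mu>\<^sub>t u \<upsilon> \<and>
     monad_opmorphism X t \<eta>\<^sub>t \<mu>\<^sub>t A s \<eta>\<^sub>s \<mu>\<^sub>s f \<phi> \<and>
     \<alpha> \<in> cells K (f \<star> u) s \<and>
     \<beta> \<in> cells K (\<one> X) (t \<star> u \<star> f) \<and>
     \<mu>\<^sub>s \<cdot> (\<alpha> \<lhd> s)
       = \<mu>\<^sub>s \<cdot> (s \<rhd> \<alpha>) \<cdot> \<a>[s, f, u] \<cdot> (\<phi> \<lhd> u) \<cdot> \<a>\<^sup>-[f, t, u] \<cdot> (f \<rhd> \<upsilon>) \<cdot> \<a>[f, u, s] \<and>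
     (\<mu>\<^sub>t \<lhd> (u \<star> f)) \<cdot> \<a>\<^sup>-[t, t, u \<star> f] \<cdot> (t \<rhd> \<beta>) \<cdot> \<r>\<^sup>-[t]
       = (\<mu>\<^sub>t \<lhd> (u \<star> f)) \<cdot> \<a>\<^sup>-[t, t, u \<star> f] \<cdot> (t \<rhd> \<a>[t, u, f]) \<cdot> (t \<rhd> (\<upsilon> \<lhd> f))
         \<cdot> (t \<rhd> \<a>\<^sup>-[u, s, f]) \<cdot> (t \<rhd> u \<rhd> \<phi>) \<cdot> (t \<rhd> \<a>[u, f, t]) \<cdot> \<a>[t, u \<star> f, t]
         \<cdot> (\<beta> \<lhd> t) \<cdot> \<l>\<^sup>-[t] \<and>
     (\<eta>\<^sub>s \<lhd> f) \<cdot> \<l>\<^sup>-[f]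
       = (\<mu>\<^sub>s \<lhd> f) \<cdot> \<a>\<^sup>-[s, s, f] \<cdot> (s \<rhd> (\<alpha> \<lhd> f)) \<cdot> (s \<rhd> \<a>\<^sup>-[f, u, f]) \<cdot> \<a>[s, f, u \<star> f]
         \<cdot> (\<phi> \<lhd> (u \<star> f)) \<cdot> \<a>\<^sup>-[f, t, u \<star> f] \<cdot> (f \<rhd> \<beta>) \<cdot> \<r>\<^sup>-[f] \<and>
     (\<eta>\<^sub>t \<lhd> u) \<cdot> \<l>\<^sup>-[u]
       = (\<mu>\<^sub>t \<lhd> u) \<cdot> \<a>\<^sup>-[t, t, u] \<cdot> (t \<rhd> \<upsilon>) \<cdot> (t \<rhd> u \<rhd> \<alpha>) \<cdot> (t \<rhd> \<a>[u, f, u])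
         \<cdot> \<a>[t, u \<star> f, u] \<cdot> (\<beta> \<lhd> u) \<cdot> \<l>\<^sup>-[u]"


section \<open>Adjunction cores\<close>

text \<open>\<open>(u, g, \<pi>)\<close> between \<open>(A, s)\<close> and \<open>(X, t)\<close>, where \<open>g : A \<rightarrow> X\<close>.\<close>

definition adjunction_core :: "'o \<Rightarrow> 'm \<Rightarrow> 'o \<Rightarrow> 'm \<Rightarrow> 'm \<Rightarrow> 'm \<Rightarrow> 'c \<Rightarrow> bool" where
  "adjunction_core A s X t u g \<pi> \<longleftrightarrow>
     u \<in> hom K A X \<and> g \<in> hom K A X \<and>
     \<pi> \<in> cells K (g \<star> s) (t \<star> u) \<and> invertible K \<pi>"

text \<open>\<open>\<mu>u \<cdot> t\<upsilon> \<cdot> tu\<epsilon>s \<cdot> \<beta>gs : gs \<Rightarrow> tu\<close>, where \<open>\<epsilon> : fg \<Rightarrow> 1\<close> is the counit of \<open>f \<stileturn> g\<close>.\<close>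

definition associated_core ::
  "'m \<Rightarrow> 'm \<Rightarrow> 'c \<Rightarrow> 'm \<Rightarrow> 'm \<Rightarrow> 'c \<Rightarrow> 'm \<Rightarrow> 'c \<Rightarrow> 'c \<Rightarrow> 'c" where
  "associated_core s t \<mu>\<^sub>t f g \<epsilon> u \<upsilon> \<beta> =
     (\<mu>\<^sub>t \<lhd> u) \<cdot> \<a>\<^sup>-[t, t, u] \<cdot> (t \<rhd> \<upsilon>)
     \<cdot> (t \<rhd> u \<rhd> \<l>[s]) \<cdot> (t \<rhd> u \<rhd> (\<epsilon> \<lhd> s)) \<cdot> (t \<rhd> u \<rhd> \<a>\<^sup>-[f, g, s])
     \<cdot> (t \<rhd> \<a>[u, f, g \<star> s]) \<cdot> \<a>[t, u \<star> f, g \<star> s] \<cdot> (\<beta> \<lhd> (g \<star> s)) \<cdot> \<l>\<^sup>-[g \<star> s]"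

text \<open>\<open>\<phi>, \<upsilon>, \<alpha>, \<beta>\<close> extend the core \<open>(u, g, \<pi>)\<close> to an adjunction in \<open>KL(K)\<close>.\<close>

definition extends_core ::
  "'o \<Rightarrow> 'm \<Rightarrow> 'c \<Rightarrow> 'c \<Rightarrow> 'o \<Rightarrow> 'm \<Rightarrow> 'c \<Rightarrow> 'c \<Rightarrow>
   'm \<Rightarrow> 'm \<Rightarrow> 'c \<Rightarrow> 'm \<Rightarrow> 'c \<Rightarrow> 'c \<Rightarrow> 'c \<Rightarrow> 'c \<Rightarrow> 'c \<Rightarrow> bool" where
  "extends_core A s \<eta>\<^sub>s \<mu>\<^sub>s X t \<eta>\<^sub>t \<mu>\<^sub>t f g \<epsilon> u \<pi> \<phi> \<upsilon> \<alpha> \<beta> \<longleftrightarrow>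
     KL_adjunction A s \<eta>\<^sub>s \<mu>\<^sub>s X t \<eta>\<^sub>t \<mu>\<^sub>t f \<phi> u \<upsilon> \<alpha> \<beta> \<and>
     associated_core s t \<mu>\<^sub>t f g \<epsilon> u \<upsilon> \<beta> = \<pi>"

end

end

theory Submission
  imports Defs
begin

text \<open>
Transport along \<open>\<pi> : gs \<Rightarrow> tu\<close> makes the free right \<open>s\<close>-module \<open>gs\<close> also a left \<open>t\<close>-module,
with action \<open>\<pi>\<^sup>-\<^sup>1 \<cdot> \<mu>u \<cdot> t\<pi>\<close>.  Both (I) and (II) say that the two actions commute, so that
\<open>gs\<close> is a \<open>t\<close>-\<open>s\<close>-bimodule: a right \<open>s\<close>-action on the free left \<open>t\<close>-module \<open>tu\<close> is \<open>t\<close>-linear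
exactly when it is the \<open>t\<close>-linear extension of its restriction \<open>\<upsilon>\<close> to \<open>u\<close>, which is (I), and
dually for (II).  This is \<open>cond_I_bimodule\<close>, \<open>bimodule_cond_I\<close>, \<open>cond_II_bimodule\<close> and
\<open>bimodule_cond_II\<close>.

An adjunction in \<open>KL(K)\<close> is compared with the bimodule structure through mates under \<open>f \<stileturn> g\<close>.
The mate of \<open>\<beta>\<close> is a cell \<open>g \<Rightarrow> tu\<close>, that of \<open>\<alpha>\<close> a cell \<open>u \<Rightarrow> gs\<close>, that of \<open>\<phi>\<close> a cell
\<open>tg \<Rightarrow> gs\<close>.  If the associated core is \<open>\<pi>\<close>, then the adjunction equations force these mates to be
\<open>\<beta>'\<close>, \<open>\<alpha>'\<close> and \<open>\<psi>\<close> (\<open>BB_mate\<close>, \<open>AA_mate\<close>, \<open>PS_mate\<close>); moreover the multiplicativity of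
the given \<open>us \<Rightarrow> tu\<close> gives the \<open>s\<close>-linearity of \<open>\<pi>\<close> (\<open>PI_right_linear\<close>), and then this cell is \<open>\<upsilon>\<close>
(\<open>Up_eq_UU\<close>).  That proves uniqueness and (I).  Conversely (I) and (II) recover \<open>\<pi>\<close> from \<open>\<upsilon>\<close>
and \<open>\<beta>'\<close>, and \<open>\<pi>\<^sup>-\<^sup>1\<close> from \<open>\<psi>\<close> and \<open>\<alpha>'\<close> (\<open>PI_from_UU\<close>, \<open>PJ_from_PS\<close>), and with \<open>\<phi>\<close>,
\<open>\<alpha>\<close>, \<open>\<beta>\<close> defined as mates every equation of an adjunction follows (\<open>equations_hold\<close>).

The constraints of the bicategory are removed once and for all by letting every composite of
one-cells act by composition on the one-cells \<open>z\<close> into its source.  A bracketed composite such as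
\<open>(tu)f\<close> then acts by the iterated composite \<open>t(u(fz))\<close>, whatever its bracketing and units,
and a two-cell acts by a natural family of cells between such iterated composites.  The
constraints act by identities (\<open>strict_asc\<close>, \<open>strict_lunit\<close>, \<open>strict_runit\<close>), and two parallel
cells are equal when their families agree (\<open>strict_eqI\<close>).  Hence each equation
between cells of \<open>K\<close> is equivalent to its constraint-free reading at every \<open>z\<close>
(\<open>strict_eq_iff\<close>), and the argument above is carried out for natural families.
\<close>

section \<open>Computing with typed pastings\<close>

context bicategory
begin

lemma cells_iff: "x \<in> cells K p q \<longleftrightarrow> x \<in> Cell K \<and> vdom K x = p \<and> vcod K x = q"
  by (auto simp: cells_def)

lemma hom_iff: "f \<in> hom K A B \<longleftrightarrow> f \<in> Mor K \<and> src K f = A \<and> trg K f = B"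
  by (auto simp: hom_def)

text \<open>
  Typing is restated through the functions \<open>src\<close>, \<open>trg\<close>, \<open>vdom\<close> and \<open>vcod\<close>, instead of membership
  in hom sets with two unknown indices, so that rewriting alone computes the type of a pasting.
\<close>

lemma mor_typing [simp]:
  "f \<in> Mor K \<Longrightarrow> src K f \<in> Obj K"  "f \<in> Mor K \<Longrightarrow> trg K f \<in> Obj K"
  "B \<in> Obj K \<Longrightarrow> \<one> B \<in> Mor K"  "B \<in> Obj K \<Longrightarrow> src K (\<one> B) = B"  "B \<in> Obj K \<Longrightarrow> trg K (\<one> B) = B"
  "f \<in> Mor K \<Longrightarrow> g \<in> Mor K \<Longrightarrow> src K g = trg K f \<Longrightarrow> g \<star> f \<in> Mor K"
  "f \<in> Mor K \<Longrightarrow> g \<in> Mor K \<Longrightarrow> src K g = trg K f \<Longrightarrow> src K (g \<star> f) = src K f"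
  "f \<in> Mor K \<Longrightarrow> g \<in> Mor K \<Longrightarrow> src K g = trg K f \<Longrightarrow> trg K (g \<star> f) = trg K g"
  using mor_obj one_hom comp_hom by (auto simp: hom_iff)

lemma cell_typing [simp]:
  "x \<in> Cell K \<Longrightarrow> vdom K x \<in> Mor K"  "x \<in> Cell K \<Longrightarrow> vcod K x \<in> Mor K"
  "x \<in> Cell K \<Longrightarrow> src K (vcod K x) = src K (vdom K x)"
  "x \<in> Cell K \<Longrightarrow> trg K (vcod K x) = trg K (vdom K x)"
  using cell_mor cell_src cell_trg by auto

lemma idc_typing [simp]:
  "f \<in> Mor K \<Longrightarrow> \<i> f \<in> Cell K"  "f \<in> Mor K \<Longrightarrow> vdom K (\<i> f) = f"
  "f \<in> Mor K \<Longrightarrow> vcod K (\<i> f) = f"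
  using idc_cells by (auto simp: cells_iff)

lemma vcomp_typing [simp]:
  assumes "x \<in> Cell K" "y \<in> Cell K" "vcod K x = vdom K y"
  shows "y \<cdot> x \<in> Cell K" "vdom K (y \<cdot> x) = vdom K x" "vcod K (y \<cdot> x) = vcod K y"
  using vcomp_cells[of x "vdom K x" "vcod K x" y "vcod K y"] assms by (auto simp: cells_iff)

lemma hcomp_typing [simp]:
  assumes "x \<in> Cell K" "y \<in> Cell K" "src K (vdom K y) = trg K (vdom K x)"
  shows "y \<odot> x \<in> Cell K" "vdom K (y \<odot> x) = vdom K y \<star> vdom K x"
    "vcod K (y \<odot> x) = vcod K y \<star> vcod K x"
  using hcomp_cells[of x "vdom K x" "vcod K x" y "vdom K y" "vcod K y"] assms
  by (auto simp: cells_iff)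

lemma vcomp_simps [simp]:
  "x \<in> Cell K \<Longrightarrow> vdom K x = p \<Longrightarrow> x \<cdot> \<i> p = x"
  "x \<in> Cell K \<Longrightarrow> vcod K x = p \<Longrightarrow> \<i> p \<cdot> x = x"
  "x \<in> Cell K \<Longrightarrow> y \<in> Cell K \<Longrightarrow> w \<in> Cell K \<Longrightarrow> vcod K x = vdom K y \<Longrightarrow> vcod K y = vdom K w \<Longrightarrow>
    (w \<cdot> y) \<cdot> x = w \<cdot> (y \<cdot> x)"
  using vcomp_idc idc_vcomp vcomp_assoc by (auto simp: cells_iff)

lemma whisker_simps [simp]:
  "f \<in> Mor K \<Longrightarrow> g \<in> Mor K \<Longrightarrow> src K g = trg K f \<Longrightarrow> \<i> g \<odot> \<i> f = \<i> (g \<star> f)"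
  "x \<in> Cell K \<Longrightarrow> y \<in> Cell K \<Longrightarrow> vcod K x = vdom K y \<Longrightarrow> p \<in> Mor K \<Longrightarrow> src K p = trg K (vdom K x) \<Longrightarrow>
    p \<rhd> (y \<cdot> x) = (p \<rhd> y) \<cdot> (p \<rhd> x)"
  "x \<in> Cell K \<Longrightarrow> y \<in> Cell K \<Longrightarrow> vcod K x = vdom K y \<Longrightarrow> p \<in> Mor K \<Longrightarrow> trg K p = src K (vdom K x) \<Longrightarrow>
    (y \<cdot> x) \<lhd> p = (y \<lhd> p) \<cdot> (x \<lhd> p)"
  using hcomp_idc apply blast
  using interchange[of x "vdom K x" "vcod K x" y "vcod K y" "\<i> p" p p "\<i> p" p]
  apply (simp add: cells_iff)
  using interchange[of "\<i> p" p p "\<i> p" p  x "vdom K x" "vcod K x" y "vcod K y"]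
  apply (simp add: cells_iff)
  done

lemma hcomp_eq:
  assumes "x \<in> Cell K" "y \<in> Cell K" "src K (vdom K y) = trg K (vdom K x)"
  shows "(y \<lhd> vcod K x) \<cdot> (vdom K y \<rhd> x) = y \<odot> x"
    and "(vcod K y \<rhd> x) \<cdot> (y \<lhd> vdom K x) = y \<odot> x"
  using interchange[of x "vdom K x" "vcod K x" "\<i> (vcod K x)" "vcod K x" "\<i> (vdom K y)" "vdom K y" "vdom K y" y "vcod K y"]
    interchange[of "\<i> (vdom K x)" "vdom K x" "vdom K x" x "vcod K x"  y "vdom K y" "vcod K y" "\<i> (vcod K y)" "vcod K y" ]
  using assms by (simp_all add: cells_iff)

lemma whisker_exchange:
  assumes "x \<in> Cell K" "y \<in> Cell K" "src K (vdom K y) = trg K (vdom K x)"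
    "vdom K x = p" "vcod K x = p'" "vdom K y = q" "vcod K y = q'"
  shows "(y \<lhd> p') \<cdot> (q \<rhd> x) = (q' \<rhd> x) \<cdot> (y \<lhd> p)"
  using hcomp_eq assms by metis

lemma is_inverse_unique: "is_inverse K x y \<Longrightarrow> is_inverse K x y' \<Longrightarrow> y = y'"
proof -
  assume a: "is_inverse K x y" and b: "is_inverse K x y'"
  have "y = y \<cdot> \<i> (vcod K x)" using a b by (simp add: is_inverse_def cells_iff)
  also have "\<dots> = y \<cdot> (x \<cdot> y')" using b by (simp add: is_inverse_def)
  also have "\<dots> = (y \<cdot> x) \<cdot> y'"
    using a b by (subst vcomp_simps(3)) (auto simp: is_inverse_def cells_iff)
  also have "\<dots> = y'" using a b by (simp add: is_inverse_def cells_iff)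
  finally show ?thesis .
qed

lemma inv_cell:
  assumes "invertible K x" shows "is_inverse K x (inv_cell K x)"
proof -
  obtain y where y: "is_inverse K x y" using assms by (auto simp: invertible_def)
  show ?thesis unfolding inv_cell_def
    by (rule theI[of "is_inverse K x", OF y]) (rule is_inverse_unique[OF _ y])
qed

lemma invertible_cell: "invertible K x \<Longrightarrow> x \<in> Cell K"
  by (auto simp: invertible_def is_inverse_def)

lemma inv_cell_simps [simp]:
  assumes "invertible K x"
  shows "inv_cell K x \<in> Cell K" "vdom K (inv_cell K x) = vcod K x" "vcod K (inv_cell K x) = vdom K x"
   "inv_cell K x \<cdot> x = \<i> (vdom K x)" "x \<cdot> inv_cell K x = \<i> (vcod K x)"
  using inv_cell[OF assms] by (auto simp: is_inverse_def cells_iff)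

lemma inv_cell_tail [simp]:
  assumes "x \<in> Cell K" "invertible K x" "k \<in> Cell K"
  shows "vcod K k = vdom K x \<Longrightarrow> inv_cell K x \<cdot> (x \<cdot> k) = k"
    and "vcod K k = vcod K x \<Longrightarrow> x \<cdot> (inv_cell K x \<cdot> k) = k"
  using assms by (simp_all flip: vcomp_simps(3))

lemma invertible_vcomp:
  assumes "invertible K x" "invertible K y" and [simp]: "vcod K x = vdom K y"
  shows "invertible K (y \<cdot> x)"
proof -
  have "is_inverse K (y \<cdot> x) (inv_cell K x \<cdot> inv_cell K y)"
    using assms(1,2)[THEN invertible_cell] assms(1,2)
    unfolding is_inverse_def by (simp add: cells_iff)
  then show ?thesis by (auto simp: invertible_def)
qed

lemma invertible_idc: "p \<in> Mor K \<Longrightarrow> invertible K (\<i> p)"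
  unfolding invertible_def is_inverse_def by (rule exI[of _ "\<i> p"]) (simp add: cells_iff)

lemma invertible_lwhisker:
  assumes "invertible K x" "p \<in> Mor K" "src K p = trg K (vdom K x)"
  shows "invertible K (p \<rhd> x)"
proof -
  have "is_inverse K (p \<rhd> x) (p \<rhd> inv_cell K x)"
    using invertible_cell[OF assms(1)] assms whisker_simps(2)[of x "inv_cell K x" p] whisker_simps(2)[of "inv_cell K x" x p]
    unfolding is_inverse_def by (simp add: cells_iff)
  then show ?thesis by (auto simp: invertible_def)
qed

lemma asc_typing [simp]:
  assumes "f \<in> Mor K" "g \<in> Mor K" "h \<in> Mor K" "src K g = trg K f" "src K h = trg K g"
  shows "\<a>[h, g, f] \<in> Cell K" "vdom K \<a>[h, g, f] = (h \<star> g) \<star> f" "vcod K \<a>[h, g, f] = h \<star> g \<star> f"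
    "invertible K \<a>[h, g, f]"
  using asc_cells[of f "src K f" "trg K f" g "trg K g" h "trg K h"]
    asc_invertible[of f "src K f" "trg K f" g "trg K g" h "trg K h"] assms
  by (auto simp: cells_iff hom_iff)

lemma unit_typing [simp]:
  assumes "f \<in> Mor K"
  shows "\<l>[f] \<in> Cell K" "vdom K \<l>[f] = \<one> (trg K f) \<star> f" "vcod K \<l>[f] = f" "invertible K \<l>[f]"
  "\<r>[f] \<in> Cell K" "vdom K \<r>[f] = f \<star> \<one> (src K f)" "vcod K \<r>[f] = f" "invertible K \<r>[f]"
  using lunit_cells[of f "src K f" "trg K f"] runit_cells[of f "src K f" "trg K f"]
  lunit_invertible[of f] runit_invertible[of f] assms
  by (auto simp: cells_iff hom_iff)

lemma asc_nat:
  assumes "x \<in> Cell K" "y \<in> Cell K" "w \<in> Cell K" "src K (vdom K y) = trg K (vdom K x)" "src K (vdom K w) = trg K (vdom K y)"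
  shows "\<a>[vcod K w, vcod K y, vcod K x] \<cdot> ((w \<odot> y) \<odot> x) = (w \<odot> (y \<odot> x)) \<cdot> \<a>[vdom K w, vdom K y, vdom K x]"
  by (rule asc_natural) (use assms in \<open>simp_all add: cells_iff\<close>)

lemma lunit_nat: "x \<in> Cell K \<Longrightarrow> \<l>[vcod K x] \<cdot> (\<one> (trg K (vdom K x)) \<rhd> x) = x \<cdot> \<l>[vdom K x]"
  by (rule lunit_natural) (simp_all add: cells_iff)

lemma runit_nat: "x \<in> Cell K \<Longrightarrow> \<r>[vcod K x] \<cdot> (x \<lhd> \<one> (src K (vdom K x))) = x \<cdot> \<r>[vdom K x]"
  by (rule runit_natural) (simp_all add: cells_iff)

lemma vcomp_left_cancel:
  assumes "invertible K i" "x \<in> Cell K" "y \<in> Cell K" "vcod K x = vdom K i" "vcod K y = vdom K i" "i \<cdot> x = i \<cdot> y"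
  shows "x = y"
proof -
  have "inv_cell K i \<cdot> (i \<cdot> x) = inv_cell K i \<cdot> (i \<cdot> y)" by (simp only: assms(6))
  then show ?thesis using invertible_cell[OF assms(1)] assms(1-5) by simp
qed

lemma vcomp_right_cancel:
  assumes "invertible K i" "x \<in> Cell K" "y \<in> Cell K" "vdom K x = vcod K i" "vdom K y = vcod K i" "x \<cdot> i = y \<cdot> i"
  shows "x = y"
proof -
  have "(x \<cdot> i) \<cdot> inv_cell K i = (y \<cdot> i) \<cdot> inv_cell K i" by (simp only: assms(6))
  then show ?thesis using invertible_cell[OF assms(1)] assms(1-5) by simp
qed

text \<open>
  Naturality of the right unit constraint exhibits \<open>x\<close> as a conjugate of its whiskering with
  the identity one-cell.
\<close>

lemma whisker_right_one_faithful:
  assumes "x \<in> Cell K" "y \<in> Cell K" "vdom K x = vdom K y" "vcod K x = vcod K y"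
    "x \<lhd> \<one> (src K (vdom K x)) = y \<lhd> \<one> (src K (vdom K x))"
  shows "x = y"
proof (rule vcomp_right_cancel[of "\<r>[vdom K x]"])
  show "x \<cdot> \<r>[vdom K x] = y \<cdot> \<r>[vdom K x]"
    using runit_nat[of x] runit_nat[of y] assms by simp
qed (use assms in auto)

lemma whisker_left_one_faithful:
  assumes "x \<in> Cell K" "y \<in> Cell K" "vdom K x = vdom K y" "vcod K x = vcod K y"
    "\<one> (trg K (vdom K x)) \<rhd> x = \<one> (trg K (vdom K x)) \<rhd> y"
  shows "x = y"
proof (rule vcomp_right_cancel[of "\<l>[vdom K x]"])
  show "x \<cdot> \<l>[vdom K x] = y \<cdot> \<l>[vdom K x]"
    using lunit_nat[of x] lunit_nat[of y] assms by simp
qed (use assms in auto)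

text \<open>
  The left unit constraint is compatible with composition.  This is not an axiom: after whiskering
  with the identity on the left, which is faithful, both sides become instances of the pentagon
  and of the middle triangle axiom.
\<close>
lemma lunit_comp:
  assumes "f \<in> Mor K" "g \<in> Mor K" "src K g = trg K f"
  shows "\<l>[g \<star> f] \<cdot> \<a>[\<one> (trg K g), g, f] = \<l>[g] \<lhd> f"
proof (rule whisker_left_one_faithful)
  let ?I = "\<one> (trg K g)"
  let ?L = "?I \<rhd> (\<l>[g \<star> f] \<cdot> \<a>[?I, g, f])" and ?R = "?I \<rhd> (\<l>[g] \<lhd> f)"
  let ?i = "\<a>[?I, ?I \<star> g, f] \<cdot> (\<a>[?I, ?I, g] \<lhd> f)"
  have h: "f \<in> hom K (src K f) (trg K f)" "g \<in> hom K (trg K f) (trg K g)" "?I \<in> hom K (trg K g) (trg K g)"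
     "g \<star> f \<in> hom K (src K f) (trg K g)"
    using assms by (auto simp: hom_iff)
  have n1: "\<a>[?I, g, f] \<cdot> ((\<r>[?I] \<lhd> g) \<lhd> f) = (\<r>[?I] \<lhd> (g \<star> f)) \<cdot> \<a>[?I \<star> ?I, g, f]"
    using asc_nat[of "\<i> f" "\<i> g" "\<r>[?I]"] assms by simp
  have n2: "\<a>[?I, g, f] \<cdot> ((?I \<rhd> \<l>[g]) \<lhd> f) = ?R \<cdot> \<a>[?I, ?I \<star> g, f]"
    using asc_nat[of "\<i> f" "\<l>[g]" "\<i> ?I"] assms by simp
  have "?L \<cdot> ?i = (?I \<rhd> \<l>[g \<star> f]) \<cdot> ((?I \<rhd> \<a>[?I, g, f]) \<cdot> ?i)"
    using assms by simp
  also have "\<dots> = (?I \<rhd> \<l>[g \<star> f]) \<cdot> (\<a>[?I, ?I, g \<star> f] \<cdot> \<a>[?I \<star> ?I, g, f])"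
    by (simp only: pentagon[OF h(1,2,3,3)])
  also have "\<dots> = ((?I \<rhd> \<l>[g \<star> f]) \<cdot> \<a>[?I, ?I, g \<star> f]) \<cdot> \<a>[?I \<star> ?I, g, f]"
    using assms by simp
  also have "\<dots> = \<a>[?I, g, f] \<cdot> ((\<r>[?I] \<lhd> g) \<lhd> f)"
    by (simp only: triangle[OF h(4,3)] n1)
  also have "\<dots> = \<a>[?I, g, f] \<cdot> (((?I \<rhd> \<l>[g]) \<cdot> \<a>[?I, ?I, g]) \<lhd> f)"
    by (simp only: triangle[OF h(2,3)])
  also have "\<dots> = (\<a>[?I, g, f] \<cdot> ((?I \<rhd> \<l>[g]) \<lhd> f)) \<cdot> (\<a>[?I, ?I, g] \<lhd> f)"
    using assms by simp
  also have "\<dots> = ?R \<cdot> ?i" 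
    using assms by (simp only: n2) simp
  finally have e: "?L \<cdot> ?i = ?R \<cdot> ?i" .
  have i: "invertible K (\<a>[?I, ?I, g] \<lhd> f)"
    unfolding invertible_def is_inverse_def
    using assms whisker_simps(3)[of "\<a>[?I, ?I, g]" "inv_cell K \<a>[?I, ?I, g]" f]
      whisker_simps(3)[of "inv_cell K \<a>[?I, ?I, g]" "\<a>[?I, ?I, g]" f]
    by (intro exI[of _ "inv_cell K \<a>[?I, ?I, g] \<lhd> f"]) (simp add: cells_iff)
  have i: "invertible K ?i"
    by (rule invertible_vcomp[OF i]) (use assms in auto)
  have "?L = ?R" by (rule vcomp_right_cancel[OF i _ _ _ _ e]) (use assms in auto)
  then show "\<one> (trg K (vdom K (\<l>[g \<star> f] \<cdot> \<a>[?I, g, f]))) \<rhd> (\<l>[g \<star> f] \<cdot> \<a>[?I, g, f]) =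
    \<one> (trg K (vdom K (\<l>[g \<star> f] \<cdot> \<a>[?I, g, f]))) \<rhd> (\<l>[g] \<lhd> f)"
    using assms by simp
qed (use assms in auto)

end

section \<open>Strictification through the action on one-cells\<close>

text \<open>
  Formal composites, which remember the bracketing and the identity one-cells.
\<close>

datatype ('o, 'm) word = Unit 'o | Gen 'm | Comp "('o, 'm) word" "('o, 'm) word"  (infixr "\<bullet>" 75)

context bicategory
begin

fun composite :: "('o, 'm) word \<Rightarrow> 'm" where
  "composite (Unit B) = \<one> B"
| "composite (Gen p) = p"
| "composite (P \<bullet> Q) = composite P \<star> composite Q"

fun composable :: "('o, 'm) word \<Rightarrow> bool" where
  "composable (Unit B) \<longleftrightarrow> B \<in> Obj K"
| "composable (Gen p) \<longleftrightarrow> p \<in> Mor K"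
| "composable (P \<bullet> Q) \<longleftrightarrow> composable P \<and> composable Q \<and> src K (composite P) = trg K (composite Q)"

text \<open>
  The functor that a word induces on one-cells \<open>z\<close>, by letting its letters act one after the
  other; it depends only on the sequence of letters and not on the bracketing.
\<close>

fun act :: "('o, 'm) word \<Rightarrow> 'm \<Rightarrow> 'm" where
  "act (Unit B) z = z"
| "act (Gen p) z = p \<star> z"
| "act (P \<bullet> Q) z = act P (act Q z)"

fun act_cell :: "('o, 'm) word \<Rightarrow> 'c \<Rightarrow> 'c" where
  "act_cell (Unit B) y = y"
| "act_cell (Gen p) y = p \<rhd> y"
| "act_cell (P \<bullet> Q) y = act_cell P (act_cell Q y)"

text \<open>
  The canonical isomorphism from \<open>P \<star> z\<close>, for the composite of the word \<open>P\<close>, to the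
  right-bracketed composite in which the letters of \<open>P\<close> act on \<open>z\<close>.
\<close>

fun unbracket :: "('o, 'm) word \<Rightarrow> 'm \<Rightarrow> 'c" where
  "unbracket (Unit B) z = \<l>[z]"
| "unbracket (Gen p) z = \<i> (p \<star> z)"
| "unbracket (P \<bullet> Q) z = unbracket P (act Q z) \<cdot> (composite P \<rhd> unbracket Q z) \<cdot> \<a>[composite P, composite Q, z]"

lemma composite_Mor [simp]: "composable P \<Longrightarrow> composite P \<in> Mor K"
  by (induction P) auto

lemma act_typing [simp]:
  assumes "composable P" "z \<in> Mor K" "trg K z = src K (composite P)"
  shows "act P z \<in> Mor K" "src K (act P z) = src K z" "trg K (act P z) = trg K (composite P)"
  using assms by (induction P arbitrary: z) auto

lemma act_cell_typing [simp]:
  assumes "composable P" "y \<in> Cell K" "trg K (vdom K y) = src K (composite P)"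
  shows "act_cell P y \<in> Cell K" "vdom K (act_cell P y) = act P (vdom K y)"
    "vcod K (act_cell P y) = act P (vcod K y)"
  using assms by (induction P arbitrary: y) auto

lemma act_cell_vcomp [simp]:
  assumes "composable P" "y \<in> Cell K" "x \<in> Cell K" "vcod K x = vdom K y" "trg K (vdom K x) = src K (composite P)"
  shows "act_cell P (y \<cdot> x) = act_cell P y \<cdot> act_cell P x"
  using assms
proof (induction P arbitrary: x y)
  case (Gen p)
  then show ?case by simp
next
  case (Comp P Q)
  have "trg K (vdom K y) = src K (composite Q)" using Comp.prems cell_typing(4)[of x] by simp
  with Comp show ?case by simp
qed simp

lemma act_cell_idc [simp]:
  "composable P \<Longrightarrow> z \<in> Mor K \<Longrightarrow> trg K z = src K (composite P) \<Longrightarrow> act_cell P (\<i> z) = \<i> (act P z)"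
  by (induction P arbitrary: z) auto

lemma unbracket_typing [simp]:
  assumes "composable P" "z \<in> Mor K" "trg K z = src K (composite P)"
  shows "unbracket P z \<in> Cell K" "vdom K (unbracket P z) = composite P \<star> z" "vcod K (unbracket P z) = act P z"
  using assms by (induction P arbitrary: z) auto

lemma unbracket_invertible [simp]:
  assumes "composable P" "z \<in> Mor K" "trg K z = src K (composite P)"
  shows "invertible K (unbracket P z)"
  using assms
proof (induction P arbitrary: z)
  case (Comp P Q)
  then show ?case
    by (auto intro!: invertible_vcomp invertible_lwhisker)
qed (auto intro: invertible_idc)

lemma unbracket_natural:
  assumes "composable P" "y \<in> Cell K" "trg K (vdom K y) = src K (composite P)"
  shows "unbracket P (vcod K y) \<cdot> (composite P \<rhd> y) = act_cell P y \<cdot> unbracket P (vdom K y)"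
  using assms
proof (induction P arbitrary: y)
  case (Unit B)
  then show ?case using lunit_nat[of y] by simp
next
  case (Gen p)
  then show ?case by simp
next
  case (Comp P Q)
  let ?p = "composite P" and ?q = "composite Q" and ?z = "vdom K y" and ?z' = "vcod K y"
  have [simp]: "composable P" "composable Q" "y \<in> Cell K" "trg K ?z = src K ?q" "src K ?p = trg K ?q"
    using Comp.prems by auto
  have 1: "\<a>[?p, ?q, ?z'] \<cdot> ((?p \<star> ?q) \<rhd> y) = (?p \<rhd> ?q \<rhd> y) \<cdot> \<a>[?p, ?q, ?z]"
    using asc_nat[of y "\<i> ?q" "\<i> ?p"] by simp
  have 2: "(?p \<rhd> unbracket Q ?z') \<cdot> (?p \<rhd> ?q \<rhd> y) = (?p \<rhd> act_cell Q y) \<cdot> (?p \<rhd> unbracket Q ?z)"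
    using arg_cong[OF Comp.IH(2)[of y], of "\<lambda>x. ?p \<rhd> x"] by simp
  have 3: "unbracket P (act Q ?z') \<cdot> (?p \<rhd> act_cell Q y) = act_cell P (act_cell Q y) \<cdot> unbracket P (act Q ?z)"
    using Comp.IH(1)[of "act_cell Q y"] by simp
  have "unbracket (P \<bullet> Q) ?z' \<cdot> (composite (P \<bullet> Q) \<rhd> y)
      = unbracket P (act Q ?z') \<cdot> (?p \<rhd> unbracket Q ?z') \<cdot> (\<a>[?p, ?q, ?z'] \<cdot> ((?p \<star> ?q) \<rhd> y))"
    by simp
  also have "\<dots> = unbracket P (act Q ?z') \<cdot> ((?p \<rhd> unbracket Q ?z') \<cdot> (?p \<rhd> ?q \<rhd> y)) \<cdot> \<a>[?p, ?q, ?z]"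
    unfolding 1 by simp
  also have "\<dots> = (unbracket P (act Q ?z') \<cdot> (?p \<rhd> act_cell Q y)) \<cdot> (?p \<rhd> unbracket Q ?z) \<cdot> \<a>[?p, ?q, ?z]"
    unfolding 2 by simp
  also have "\<dots> = act_cell (P \<bullet> Q) y \<cdot> unbracket (P \<bullet> Q) ?z"
    unfolding 3 by simp
  finally show ?case .
qed

text \<open>
  \<open>X\<close> is the family through which the two-cell \<open>x\<close> acts on one-cells.  The square with the canonical
  isomorphisms determines \<open>X\<close>, and stated as a square it needs no inverses.
\<close>

definition strictifies :: "('o, 'm) word \<Rightarrow> ('o, 'm) word \<Rightarrow> 'c \<Rightarrow> ('m \<Rightarrow> 'c) \<Rightarrow> bool" where
  "strictifies P P' x X \<longleftrightarrow> composable P \<and> composable P' \<and> x \<in> cells K (composite P) (composite P') \<and>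
    (\<forall>z. z \<in> Mor K \<and> trg K z = src K (composite P) \<longrightarrow>
      X z \<in> cells K (act P z) (act P' z) \<and> X z \<cdot> unbracket P z = unbracket P' z \<cdot> (x \<lhd> z))"

lemma strictifiesD:
  assumes "strictifies P P' x X"
  shows "composable P" "composable P'" "x \<in> Cell K" "vdom K x = composite P" "vcod K x = composite P'"
    "src K (composite P') = src K (composite P)" "trg K (composite P') = trg K (composite P)"
    "z \<in> Mor K \<Longrightarrow> trg K z = src K (composite P) \<Longrightarrow> X z \<in> Cell K"
    "z \<in> Mor K \<Longrightarrow> trg K z = src K (composite P) \<Longrightarrow> vdom K (X z) = act P z"
    "z \<in> Mor K \<Longrightarrow> trg K z = src K (composite P) \<Longrightarrow> vcod K (X z) = act P' z"
    "z \<in> Mor K \<Longrightarrow> trg K z = src K (composite P) \<Longrightarrow> X z \<cdot> unbracket P z = unbracket P' z \<cdot> (x \<lhd> z)"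
  using assms cell_src[of x] cell_trg[of x] by (auto simp: strictifies_def cells_iff)

lemma strict_eqD:
  assumes "x = y" "strictifies P P' x X" "strictifies P P' y Y" "z \<in> Mor K" "trg K z = src K (composite P)"
  shows "X z = Y z"
  by (rule vcomp_right_cancel[of "unbracket P z"])
     (use assms strictifiesD[OF assms(2)] strictifiesD[OF assms(3)] in auto)

text \<open>
  The action is faithful already at the identity one-cell.
\<close>

lemma strict_eqI:
  assumes x: "strictifies P P' x X" and y: "strictifies P P' y Y"
    and eq: "\<And>z. z \<in> Mor K \<Longrightarrow> trg K z = src K (composite P) \<Longrightarrow> X z = Y z"
  shows "x = y"
proof (rule whisker_right_one_faithful)
  let ?I = "\<one> (src K (composite P))"
  note x' = strictifiesD[OF x] and y' = strictifiesD[OF y]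
  have "unbracket P' ?I \<cdot> (x \<lhd> ?I) = unbracket P' ?I \<cdot> (y \<lhd> ?I)"
    using x'(11)[of ?I] y'(11)[of ?I] eq[of ?I] x'(1) by simp
  then have "x \<lhd> ?I = y \<lhd> ?I"
    by (rule vcomp_left_cancel[rotated -1]) (use x' y' in auto)
  then show "x \<lhd> \<one> (src K (vdom K x)) = y \<lhd> \<one> (src K (vdom K x))" using x' by simp
qed (use strictifiesD[OF x] strictifiesD[OF y] in auto)

lemma strict_natural:
  assumes s: "strictifies P P' x X" and y: "y \<in> Cell K" "trg K (vdom K y) = src K (composite P)"
  shows "X (vcod K y) \<cdot> act_cell P y = act_cell P' y \<cdot> X (vdom K y)"
proof (rule vcomp_right_cancel[of "unbracket P (vdom K y)"])
  let ?z = "vdom K y" and ?z' = "vcod K y"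
  note [simp] = strictifiesD(1-7)[OF s] y strictifiesD(8-10)[OF s]
  have "(X ?z' \<cdot> act_cell P y) \<cdot> unbracket P ?z = X ?z' \<cdot> (act_cell P y \<cdot> unbracket P ?z)"
    by simp
  also have "\<dots> = (X ?z' \<cdot> unbracket P ?z') \<cdot> (composite P \<rhd> y)"
    using unbracket_natural[of P y] by (simp flip: unbracket_natural)
  also have "\<dots> = unbracket P' ?z' \<cdot> ((x \<lhd> ?z') \<cdot> (composite P \<rhd> y))"
    using strictifiesD(11)[OF s, of ?z'] by simp
  also have "(x \<lhd> ?z') \<cdot> (composite P \<rhd> y) = (composite P' \<rhd> y) \<cdot> (x \<lhd> ?z)"
    by (rule whisker_exchange) simp_all
  also have "unbracket P' ?z' \<cdot> ((composite P' \<rhd> y) \<cdot> (x \<lhd> ?z)) = (unbracket P' ?z' \<cdot> (composite P' \<rhd> y)) \<cdot> (x \<lhd> ?z)"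
    by simp
  also have "\<dots> = act_cell P' y \<cdot> (unbracket P' ?z \<cdot> (x \<lhd> ?z))"
    by (subst unbracket_natural) simp_all
  also have "\<dots> = (act_cell P' y \<cdot> X ?z) \<cdot> unbracket P ?z"
    using strictifiesD(11)[OF s, of ?z] by simp
  finally show "(X ?z' \<cdot> act_cell P y) \<cdot> unbracket P ?z = (act_cell P' y \<cdot> X ?z) \<cdot> unbracket P ?z" .
qed (use strictifiesD(1-10)[OF s] y in simp_all)

text \<open>
  Conjugation with the canonical isomorphisms solves the square for the family.
\<close>

definition family :: "('o, 'm) word \<Rightarrow> ('o, 'm) word \<Rightarrow> 'c \<Rightarrow> 'm \<Rightarrow> 'c" where
  "family P P' x z = unbracket P' z \<cdot> (x \<lhd> z) \<cdot> inv_cell K (unbracket P z)"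

lemma strict_family:
  assumes "composable P" "composable P'" "x \<in> cells K (composite P) (composite P')"
  shows "strictifies P P' x (family P P' x)"
proof -
  have [simp]: "x \<in> Cell K" "vdom K x = composite P" "vcod K x = composite P'" "src K (composite P') = src K (composite P)"
    using assms cell_src[of x] by (auto simp: cells_iff)
  show ?thesis using assms by (auto simp: strictifies_def cells_iff family_def)
qed

lemma strict_cong:
  assumes "strictifies P P' x X" "\<And>z. z \<in> Mor K \<Longrightarrow> trg K z = src K (composite P) \<Longrightarrow> X z = X' z"
  shows "strictifies P P' x X'"
  using assms by (auto simp: strictifies_def)

lemma strict_vcomp:
  assumes "strictifies P P' x X" "strictifies P' P'' y Y"
  shows "strictifies P P'' (y \<cdot> x) (\<lambda>z. Y z \<cdot> X z)"
proof -
  note [simp] = strictifiesD(1-10)[OF assms(1)] strictifiesD(1-10)[OF assms(2)]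
  have "(Y z \<cdot> X z) \<cdot> unbracket P z = unbracket P'' z \<cdot> ((y \<cdot> x) \<lhd> z)"
    if z: "z \<in> Mor K" "trg K z = src K (composite P)" for z
  proof -
    have "(Y z \<cdot> X z) \<cdot> unbracket P z = Y z \<cdot> (X z \<cdot> unbracket P z)" using z by simp
    also have "\<dots> = (Y z \<cdot> unbracket P' z) \<cdot> (x \<lhd> z)" using strictifiesD(11)[OF assms(1) z] z by simp
    also have "\<dots> = unbracket P'' z \<cdot> ((y \<cdot> x) \<lhd> z)" using strictifiesD(11)[OF assms(2), of z] z by simp
    finally show ?thesis .
  qed
  then show ?thesis by (auto simp: strictifies_def cells_iff)
qed

text \<open>
  Whiskering on the left applies a functor to the family; whiskering on the right, treated next,
  reindexes it.  Both use that \<open>\<a>\<close> is natural; the first also needs the naturality of the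
  canonical isomorphisms, the second the interchange law.
\<close>

lemma strict_lwhisker:
  assumes s: "strictifies Q Q' y Y" and p: "composable P" "p = composite P" "src K p = trg K (composite Q)"
  shows "strictifies (P \<bullet> Q) (P \<bullet> Q') (p \<rhd> y) (\<lambda>z. act_cell P (Y z))"
proof -
  note [simp] = strictifiesD(1-10)[OF s] p
  have src [simp]: "src K (composite P) = trg K (composite Q)" using p by simp
  have "act_cell P (Y z) \<cdot> unbracket (P \<bullet> Q) z = unbracket (P \<bullet> Q') z \<cdot> ((p \<rhd> y) \<lhd> z)"
    if z: "z \<in> Mor K" "trg K z = src K (composite Q)" for z
  proof -
    note [simp] = z
    have 1: "\<a>[composite P, composite Q', z] \<cdot> ((composite P \<rhd> y) \<lhd> z) = (composite P \<rhd> (y \<lhd> z)) \<cdot> \<a>[composite P, composite Q, z]"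
      using asc_nat[of "\<i> z" y "\<i> (composite P)"] by simp
    have 2: "(composite P \<rhd> unbracket Q' z) \<cdot> (composite P \<rhd> (y \<lhd> z)) = (composite P \<rhd> Y z) \<cdot> (composite P \<rhd> unbracket Q z)"
      using arg_cong[OF strictifiesD(11)[OF s z], of "\<lambda>x. composite P \<rhd> x"] by simp
    have 3: "unbracket P (act Q' z) \<cdot> (composite P \<rhd> Y z) = act_cell P (Y z) \<cdot> unbracket P (act Q z)"
      using unbracket_natural[of P "Y z"] by simp
    have "unbracket (P \<bullet> Q') z \<cdot> ((p \<rhd> y) \<lhd> z)
        = unbracket P (act Q' z) \<cdot> (composite P \<rhd> unbracket Q' z) \<cdot> (\<a>[composite P, composite Q', z] \<cdot> ((composite P \<rhd> y) \<lhd> z))" by simp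
    also have "\<dots> = unbracket P (act Q' z) \<cdot> ((composite P \<rhd> unbracket Q' z) \<cdot> (composite P \<rhd> (y \<lhd> z))) \<cdot> \<a>[composite P, composite Q, z]"
      unfolding 1 by simp
    also have "\<dots> = (unbracket P (act Q' z) \<cdot> (composite P \<rhd> Y z)) \<cdot> (composite P \<rhd> unbracket Q z) \<cdot> \<a>[composite P, composite Q, z]"
      unfolding 2 by simp
    also have "\<dots> = act_cell P (Y z) \<cdot> unbracket (P \<bullet> Q) z" unfolding 3 by simp
    finally show ?thesis by simp
  qed
  then show ?thesis by (auto simp: strictifies_def cells_iff)
qed

lemma strict_rwhisker:
  assumes s: "strictifies P P' x X" and q: "composable Q" "q = composite Q" "src K (composite P) = trg K q"
  shows "strictifies (P \<bullet> Q) (P' \<bullet> Q) (x \<lhd> q) (\<lambda>z. X (act Q z))"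
proof -
  note [simp] = strictifiesD(1-10)[OF s] q
  have "X (act Q z) \<cdot> unbracket (P \<bullet> Q) z = unbracket (P' \<bullet> Q) z \<cdot> ((x \<lhd> q) \<lhd> z)"
    if z: "z \<in> Mor K" "trg K z = src K (composite Q)" for z
  proof -
    note [simp] = z
    have 1: "\<a>[composite P', composite Q, z] \<cdot> ((x \<lhd> composite Q) \<lhd> z) = (x \<lhd> (composite Q \<star> z)) \<cdot> \<a>[composite P, composite Q, z]"
      using asc_nat[of "\<i> z" "\<i> (composite Q)" x] by simp
    have 2: "(composite P' \<rhd> unbracket Q z) \<cdot> (x \<lhd> (composite Q \<star> z)) = (x \<lhd> act Q z) \<cdot> (composite P \<rhd> unbracket Q z)"
      by (rule whisker_exchange[symmetric]) simp_all
    have 3: "unbracket P' (act Q z) \<cdot> (x \<lhd> act Q z) = X (act Q z) \<cdot> unbracket P (act Q z)"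
      using strictifiesD(11)[OF s, of "act Q z"] by simp
    have "unbracket (P' \<bullet> Q) z \<cdot> ((x \<lhd> q) \<lhd> z)
        = unbracket P' (act Q z) \<cdot> (composite P' \<rhd> unbracket Q z) \<cdot> (\<a>[composite P', composite Q, z] \<cdot> ((x \<lhd> composite Q) \<lhd> z))" by simp
    also have "\<dots> = unbracket P' (act Q z) \<cdot> ((composite P' \<rhd> unbracket Q z) \<cdot> (x \<lhd> (composite Q \<star> z))) \<cdot> \<a>[composite P, composite Q, z]"
      unfolding 1 by simp
    also have "\<dots> = (unbracket P' (act Q z) \<cdot> (x \<lhd> act Q z)) \<cdot> (composite P \<rhd> unbracket Q z) \<cdot> \<a>[composite P, composite Q, z]"
      unfolding 2 by simp
    also have "\<dots> = X (act Q z) \<cdot> unbracket (P \<bullet> Q) z" unfolding 3 by simp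
    finally show ?thesis by simp
  qed
  then show ?thesis by (auto simp: strictifies_def cells_iff)
qed

lemma strict_inv:
  assumes s: "strictifies P P' x (\<lambda>z. \<i> (act P z))" and i: "invertible K x"
    and e: "\<And>z. z \<in> Mor K \<Longrightarrow> trg K z = src K (composite P) \<Longrightarrow> act P z = act P' z"
  shows "strictifies P' P (inv_cell K x) (\<lambda>z. \<i> (act P' z))"
proof -
  note [simp] = strictifiesD(1-7)[OF s] i e
  have "\<i> (act P' z) \<cdot> unbracket P' z = unbracket P z \<cdot> (inv_cell K x \<lhd> z)"
    if z: "z \<in> Mor K" "trg K z = src K (composite P)" for z
  proof -
    have "(x \<lhd> z) \<cdot> (inv_cell K x \<lhd> z) = \<i> (composite P' \<star> z)"
      using whisker_simps(3)[of "inv_cell K x" x z] z by simp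
    then have "unbracket P' z = (unbracket P' z \<cdot> (x \<lhd> z)) \<cdot> (inv_cell K x \<lhd> z)"
      using z by simp
    also have "unbracket P' z \<cdot> (x \<lhd> z) = unbracket P z"
      using strictifiesD(11)[OF s z] z by simp
    finally show ?thesis using z by simp
  qed
  then show ?thesis by (auto simp: strictifies_def cells_iff)
qed

text \<open>
  This is the pentagon, pasted with naturality of the associativity constraint along the canonical
  isomorphism of the rightmost word.
\<close>

lemma strict_asc:
  assumes "composable (P \<bullet> Q \<bullet> R)" and [simp]: "p = composite P" "q = composite Q" "r = composite R"
  shows "strictifies ((P \<bullet> Q) \<bullet> R) (P \<bullet> Q \<bullet> R) \<a>[p, q, r] (\<lambda>z. \<i> (act P (act Q (act R z))))"
proof -
  have [simp]: "composable P" "composable Q" "composable R" "src K (composite P) = trg K (composite Q)" "src K (composite Q) = trg K (composite R)"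
    using assms by auto
  have "unbracket ((P \<bullet> Q) \<bullet> R) z = unbracket (P \<bullet> Q \<bullet> R) z \<cdot> (\<a>[composite P, composite Q, composite R] \<lhd> z)"
    if z: "z \<in> Mor K" "trg K z = src K (composite R)" for z
  proof -
    note [simp] = z
    let ?p = "composite P" and ?q = "composite Q" and ?r = "composite R"
    have 1: "\<a>[?p, ?q, act R z] \<cdot> ((?p \<star> ?q) \<rhd> unbracket R z) = (?p \<rhd> ?q \<rhd> unbracket R z) \<cdot> \<a>[?p, ?q, ?r \<star> z]"
      using asc_nat[of "unbracket R z" "\<i> ?q" "\<i> ?p"] by simp
    have 2: "\<a>[?p, ?q, ?r \<star> z] \<cdot> \<a>[?p \<star> ?q, ?r, z] 
      = (?p \<rhd> \<a>[?q, ?r, z]) \<cdot> \<a>[?p, ?q \<star> ?r, z] \<cdot> (\<a>[?p, ?q, ?r] \<lhd> z)"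
      by (rule pentagon) (auto simp: hom_iff)
    have "unbracket ((P \<bullet> Q) \<bullet> R) z = unbracket P (act Q (act R z)) \<cdot> (?p \<rhd> unbracket Q (act R z)) \<cdot>
       (\<a>[?p, ?q, act R z] \<cdot> ((?p \<star> ?q) \<rhd> unbracket R z)) \<cdot> \<a>[?p \<star> ?q, ?r, z]" by simp
    also have "\<dots> = unbracket P (act Q (act R z)) \<cdot> (?p \<rhd> unbracket Q (act R z)) \<cdot>
       (?p \<rhd> ?q \<rhd> unbracket R z) \<cdot> (\<a>[?p, ?q, ?r \<star> z] \<cdot> \<a>[?p \<star> ?q, ?r, z])" unfolding 1 by simp
    also have "\<dots> = unbracket (P \<bullet> Q \<bullet> R) z \<cdot> (\<a>[?p, ?q, ?r] \<lhd> z)" unfolding 2 by simp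
    finally show ?thesis .
  qed
  then show ?thesis by (auto simp: strictifies_def cells_iff simp del: unbracket.simps)
qed

lemma strict_asc_inv:
  assumes "composable (P \<bullet> Q \<bullet> R)" "p = composite P" "q = composite Q" "r = composite R"
  shows "strictifies (P \<bullet> Q \<bullet> R) ((P \<bullet> Q) \<bullet> R) \<a>\<^sup>-[p, q, r] (\<lambda>z. \<i> (act P (act Q (act R z))))"
  using strict_inv[of "(P \<bullet> Q) \<bullet> R" "P \<bullet> Q \<bullet> R" "\<a>[p, q, r]"] strict_asc[OF assms] assms by simp

text \<open>
  The canonical isomorphism of a unit word is \<open>\<l>\<close>, so the left unit constraint needs
  the derived compatibility \<open>lunit_comp\<close>, and the right one needs only the triangle axiom.
\<close>

lemma strict_lunit:
  assumes "composable P" and [simp]: "p = composite P" "B = trg K p"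
  shows "strictifies (Unit B \<bullet> P) P \<l>[p] (\<lambda>z. \<i> (act P z))"
proof -
  note [simp] = assms(1)
  have "unbracket (Unit (trg K (composite P)) \<bullet> P) z = unbracket P z \<cdot> (\<l>[composite P] \<lhd> z)"
    if z: "z \<in> Mor K" "trg K z = src K (composite P)" for z
  proof -
    note [simp] = z
    have "unbracket (Unit (trg K (composite P)) \<bullet> P) z =
       (\<l>[act P z] \<cdot> (\<one> (trg K (composite P)) \<rhd> unbracket P z)) \<cdot> \<a>[\<one> (trg K (composite P)), composite P, z]" by simp
    also have "\<dots> = unbracket P z \<cdot> (\<l>[composite P \<star> z] \<cdot> \<a>[\<one> (trg K (composite P)), composite P, z])"
      using lunit_nat[of "unbracket P z"] by simp
    also have "\<dots> = unbracket P z \<cdot> (\<l>[composite P] \<lhd> z)" using lunit_comp[of z "composite P"] by simp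
    finally show ?thesis .
  qed
  then show ?thesis by (auto simp: strictifies_def cells_iff simp del: unbracket.simps)
qed

lemma strict_lunit_inv:
  assumes "composable P" "p = composite P" "B = trg K p"
  shows "strictifies P (Unit B \<bullet> P) \<l>\<^sup>-[p] (\<lambda>z. \<i> (act P z))"
  using strict_inv[of "Unit B \<bullet> P" P "\<l>[p]"] strict_lunit[OF assms] assms by simp

lemma strict_runit:
  assumes "composable P" and [simp]: "p = composite P" "B = src K p"
  shows "strictifies (P \<bullet> Unit B) P \<r>[p] (\<lambda>z. \<i> (act P z))"
proof -
  note [simp] = assms(1)
  have "unbracket (P \<bullet> Unit (src K (composite P))) z = unbracket P z \<cdot> (\<r>[composite P] \<lhd> z)"
    if z: "z \<in> Mor K" "trg K z = src K (composite P)" for z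
  proof -
    note [simp] = z
    have "(composite P \<rhd> \<l>[z]) \<cdot> \<a>[composite P, \<one> (src K (composite P)), z] = \<r>[composite P] \<lhd> z"
      by (rule triangle) (auto simp: hom_iff)
    then show ?thesis by simp
  qed
  then show ?thesis by (auto simp: strictifies_def cells_iff simp del: unbracket.simps)
qed

lemma strict_runit_inv:
  assumes "composable P" "p = composite P" "B = src K p"
  shows "strictifies P (P \<bullet> Unit B) \<r>\<^sup>-[p] (\<lambda>z. \<i> (act P z))"
  using strict_inv[of "P \<bullet> Unit B" P "\<r>[p]"] strict_runit[OF assms] assms by simp

lemma strict_idc:
  assumes "composable P" "p = composite P"
  shows "strictifies P P (\<i> p) (\<lambda>z. \<i> (act P z))"
  using assms by (auto simp: strictifies_def cells_iff)

end

section \<open>Strict forms of equations\<close>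

context bicategory
begin

text \<open>
  Coherence in the form in which it is used: an equation between pastings with constraints
  is traded for an equation between families without them.
\<close>

lemma strict_eq_iff:
  assumes x: "strictifies P P' x X" and y: "strictifies P P' y Y" and B: "src K (composite P) = B"
    and eq: "\<And>z. z \<in> Mor K \<Longrightarrow> trg K z = B \<Longrightarrow> X z = X' z"
      "\<And>z. z \<in> Mor K \<Longrightarrow> trg K z = B \<Longrightarrow> Y z = Y' z"
  shows "x = y \<longleftrightarrow> (\<forall>z. z \<in> Mor K \<and> trg K z = B \<longrightarrow> X' z = Y' z)"
  using strict_eqD[OF _ x y] strict_eqI[OF x y] eq B by auto

text \<open>
  Read backwards, these rules compute the family of any pasting from the outside in.  Since every
  rule reads off the target word from the source word, fixing the source word of the whole pasting
  leaves no choice of bracketing.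
\<close>

lemmas strict_rules = strict_vcomp strict_lwhisker strict_rwhisker strict_asc_inv strict_lunit_inv strict_runit_inv
  strict_asc strict_lunit strict_runit

text \<open>
  Oriented so that rewriting moves cells acting further to the right to a later position;
  the second form applies inside a longer right-bracketed vertical composite.
\<close>

lemma strict_naturality:
  assumes "strictifies P P' x X" "y \<in> Cell K" "trg K (vdom K y) = src K (composite P)" "z = vcod K y"
  shows "X z \<cdot> act_cell P y = act_cell P' y \<cdot> X (vdom K y)"
    and "k \<in> Cell K \<Longrightarrow> vcod K k = act P (vdom K y) \<Longrightarrow>
      X z \<cdot> (act_cell P y \<cdot> k) = act_cell P' y \<cdot> (X (vdom K y) \<cdot> k)"
proof -
  show 1: "X z \<cdot> act_cell P y = act_cell P' y \<cdot> X (vdom K y)"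
    using strict_natural[OF assms(1-3)] assms(4) by simp
  assume k: "k \<in> Cell K" "vcod K k = act P (vdom K y)"
  note [simp] = strictifiesD(1-10)[OF assms(1)] assms k
  have "X z \<cdot> (act_cell P y \<cdot> k) = (X z \<cdot> act_cell P y) \<cdot> k" by simp
  also have "\<dots> = act_cell P' y \<cdot> (X (vdom K y) \<cdot> k)" unfolding 1 by simp
  finally show "X z \<cdot> (act_cell P y \<cdot> k) = act_cell P' y \<cdot> (X (vdom K y) \<cdot> k)" .
qed

lemma vcomp_tail:
  assumes "a \<cdot> b = c" "b \<in> Cell K" "a \<in> Cell K" "vcod K b = vdom K a" "k \<in> Cell K" "vcod K k = vdom K b"
  shows "a \<cdot> (b \<cdot> k) = c \<cdot> k"
  using assms by (simp flip: assms(1))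

lemma vcomp_tail3:
  assumes "a \<cdot> b \<cdot> d = c" "d \<in> Cell K" "b \<in> Cell K" "a \<in> Cell K" "vcod K d = vdom K b" "vcod K b = vdom K a" "k \<in> Cell K" "vcod K k = vdom K d"
  shows "a \<cdot> (b \<cdot> (d \<cdot> k)) = c \<cdot> k"
  using assms by (simp flip: assms(1))

lemma monad_strict_iff:
  assumes "A \<in> Obj K" "s \<in> hom K A A"
    and h: "strictifies (Unit A) (Gen s) \<eta> H" and m: "strictifies (Gen s \<bullet> Gen s) (Gen s) \<mu> M"
  shows "monad K A s \<eta> \<mu> \<longleftrightarrow> 
    (\<forall>z. z \<in> Mor K \<and> trg K z = A \<longrightarrow> M z \<cdot> M (s \<star> z) = M z \<cdot> (s \<rhd> M z)) \<and>
    (\<forall>z. z \<in> Mor K \<and> trg K z = A \<longrightarrow> M z \<cdot> H (s \<star> z) = \<i> (s \<star> z)) \<and>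
    (\<forall>z. z \<in> Mor K \<and> trg K z = A \<longrightarrow> M z \<cdot> (s \<rhd> H z) = \<i> (s \<star> z))"
proof -
  have [simp]: "A \<in> Obj K" "s \<in> Mor K" "src K s = A" "trg K s = A"
    using assms by (auto simp: hom_iff)
  note [simp] = strictifiesD(3-10)[OF h, simplified] strictifiesD(3-10)[OF m, simplified]
  have 1: "\<mu> \<cdot> (\<mu> \<lhd> s) = \<mu> \<cdot> (s \<rhd> \<mu>) \<cdot> \<a>[s, s, s] \<longleftrightarrow>
    (\<forall>z. z \<in> Mor K \<and> trg K z = A \<longrightarrow> M z \<cdot> M (s \<star> z) = M z \<cdot> (s \<rhd> M z))"
    by (rule strict_eq_iff[where P="(Gen s \<bullet> Gen s) \<bullet> Gen s"]) (rule strict_rules h m | simp)+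
  have 2: "\<mu> \<cdot> (\<eta> \<lhd> s) = \<l>[s] \<longleftrightarrow>
    (\<forall>z. z \<in> Mor K \<and> trg K z = A \<longrightarrow> M z \<cdot> H (s \<star> z) = \<i> (s \<star> z))"
    by (rule strict_eq_iff[where P="Unit A \<bullet> Gen s"]) (rule strict_rules h m | simp)+
  have 3: "\<mu> \<cdot> (s \<rhd> \<eta>) = \<r>[s] \<longleftrightarrow>
    (\<forall>z. z \<in> Mor K \<and> trg K z = A \<longrightarrow> M z \<cdot> (s \<rhd> H z) = \<i> (s \<star> z))"
    by (rule strict_eq_iff[where P="Gen s \<bullet> Unit A"]) (rule strict_rules h m | simp)+
  show ?thesis unfolding monad_def using assms(2) by (simp add: 1 2 3 cells_iff)
qed

lemma monad_opmorphism_strict_iff: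
  assumes "s \<in> hom K A A" "s' \<in> hom K A' A'" "f \<in> hom K A A'"
    and h: "strictifies (Unit A) (Gen s) \<eta> H" and m: "strictifies (Gen s \<bullet> Gen s) (Gen s) \<mu> M"
    and h': "strictifies (Unit A') (Gen s') \<eta>' H'" and m': "strictifies (Gen s' \<bullet> Gen s') (Gen s') \<mu>' M'"
    and p: "strictifies (Gen f \<bullet> Gen s) (Gen s' \<bullet> Gen f) \<phi> F"
  shows "monad_opmorphism K A s \<eta> \<mu> A' s' \<eta>' \<mu>' f \<phi> \<longleftrightarrow> 
    (\<forall>z. z \<in> Mor K \<and> trg K z = A \<longrightarrow> M' (f \<star> z) \<cdot> (s' \<rhd> F z) \<cdot> F (s \<star> z) = F z \<cdot> (f \<rhd> M z)) \<and>
    (\<forall>z. z \<in> Mor K \<and> trg K z = A \<longrightarrow> F z \<cdot> (f \<rhd> H z) = H' (f \<star> z))"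
proof -
  have [simp]: "s \<in> Mor K" "src K s = A" "trg K s = A" 
     "s' \<in> Mor K" "src K s' = A'" "trg K s' = A'" "f \<in> Mor K" "src K f = A" "trg K f = A'"
    using assms by (auto simp: hom_iff)
  have [simp]: "A \<in> Obj K" "A' \<in> Obj K" using mor_obj[of f] by auto
  note [simp] = strictifiesD(3-10)[OF h, simplified] strictifiesD(3-10)[OF m, simplified]
     strictifiesD(3-10)[OF h', simplified] strictifiesD(3-10)[OF m', simplified] strictifiesD(3-10)[OF p, simplified]
  have 1: "(\<mu>' \<lhd> f) \<cdot> \<a>\<^sup>-[s', s', f] \<cdot> (s' \<rhd> \<phi>) \<cdot> \<a>[s', f, s] \<cdot> (\<phi> \<lhd> s)
       = \<phi> \<cdot> (f \<rhd> \<mu>) \<cdot> \<a>[f, s, s] \<longleftrightarrow>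
   (\<forall>z. z \<in> Mor K \<and> trg K z = A \<longrightarrow> M' (f \<star> z) \<cdot> (s' \<rhd> F z) \<cdot> F (s \<star> z) = F z \<cdot> (f \<rhd> M z))"
    by (rule strict_eq_iff[where P="(Gen f \<bullet> Gen s) \<bullet> Gen s"]) (rule strict_rules h m h' m' p | simp)+
  have 2: "\<phi> \<cdot> (f \<rhd> \<eta>) \<cdot> \<r>\<^sup>-[f] = (\<eta>' \<lhd> f) \<cdot> \<l>\<^sup>-[f] \<longleftrightarrow>
    (\<forall>z. z \<in> Mor K \<and> trg K z = A \<longrightarrow> F z \<cdot> (f \<rhd> H z) = H' (f \<star> z))"
    by (rule strict_eq_iff[where P="Gen f"]) (rule strict_rules h m h' m' p | simp)+
  show ?thesis unfolding monad_opmorphism_def using assms(3) by (simp add: 1 2 cells_iff)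
qed

end

section \<open>Commuting actions on a core\<close>

text \<open>
  A core in its strict form.  Capitals denote families: \<open>H\<close> and \<open>M\<close> the unit and multiplication of
  the monads \<open>s\<close> and \<open>t\<close>, \<open>HF\<close> and \<open>EF\<close> the unit and counit of \<open>f \<stileturn> g\<close>, \<open>PI\<close> and \<open>PJ\<close> the cell \<open>\<pi>\<close>
  and its inverse, and \<open>BB\<close>, \<open>AA\<close>, \<open>UU\<close>, \<open>PS\<close> the cells \<open>\<beta>'\<close>, \<open>\<alpha>'\<close>, \<open>\<upsilon>\<close>, \<open>\<psi>\<close>.  Each is tied to a cell of \<open>K\<close>,
  which makes it natural.
\<close>

locale strict_core = bicategory K for K :: "('o, 'm, 'c) bicat" (structure) +
  fixes A X :: 'o and f g s t u :: 'm and \<eta>\<^sub>s \<mu>\<^sub>s \<eta>\<^sub>t \<mu>\<^sub>t \<eta>\<^sub>f \<epsilon>\<^sub>f \<pi> \<beta>' \<alpha>' \<upsilon> \<psi> :: 'c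
    and HS MS HT MT HF EF PI PJ BB AA UU PS :: "'m \<Rightarrow> 'c"
  assumes objs [simp]: "A \<in> Obj K" "X \<in> Obj K"
    and homs: "f \<in> hom K X A" "g \<in> hom K A X" "s \<in> hom K A A" "t \<in> hom K X X" "u \<in> hom K A X"
    and HS: "strictifies (Unit A) (Gen s) \<eta>\<^sub>s HS"
    and MS: "strictifies (Gen s \<bullet> Gen s) (Gen s) \<mu>\<^sub>s MS"
    and HT: "strictifies (Unit X) (Gen t) \<eta>\<^sub>t HT"
    and MT: "strictifies (Gen t \<bullet> Gen t) (Gen t) \<mu>\<^sub>t MT"
    and HF: "strictifies (Unit X) (Gen g \<bullet> Gen f) \<eta>\<^sub>f HF"
    and EF: "strictifies (Gen f \<bullet> Gen g) (Unit A) \<epsilon>\<^sub>f EF"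
    and PI: "strictifies (Gen g \<bullet> Gen s) (Gen t \<bullet> Gen u) \<pi> PI"
    and PJ: "strictifies (Gen t \<bullet> Gen u) (Gen g \<bullet> Gen s) (inv_cell K \<pi>) PJ"
    and BB: "strictifies (Gen g) (Gen t \<bullet> Gen u) \<beta>' BB"
    and AA: "strictifies (Gen u) (Gen g \<bullet> Gen s) \<alpha>' AA"
    and UU: "strictifies (Gen u \<bullet> Gen s) (Gen t \<bullet> Gen u) \<upsilon> UU"
    and PS: "strictifies (Gen t \<bullet> Gen g) (Gen g \<bullet> Gen s) \<psi> PS"
    and MS_assoc: "z \<in> Mor K \<Longrightarrow> trg K z = A \<Longrightarrow> MS z \<cdot> (s \<rhd> MS z) = MS z \<cdot> MS (s \<star> z)"
    and MS_HS: "z \<in> Mor K \<Longrightarrow> trg K z = A \<Longrightarrow> MS z \<cdot> HS (s \<star> z) = \<i> (s \<star> z)"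
      "z \<in> Mor K \<Longrightarrow> trg K z = A \<Longrightarrow> MS z \<cdot> (s \<rhd> HS z) = \<i> (s \<star> z)"
    and MT_assoc: "z \<in> Mor K \<Longrightarrow> trg K z = X \<Longrightarrow> MT z \<cdot> (t \<rhd> MT z) = MT z \<cdot> MT (t \<star> z)"
    and MT_HT: "z \<in> Mor K \<Longrightarrow> trg K z = X \<Longrightarrow> MT z \<cdot> HT (t \<star> z) = \<i> (t \<star> z)"
      "z \<in> Mor K \<Longrightarrow> trg K z = X \<Longrightarrow> MT z \<cdot> (t \<rhd> HT z) = \<i> (t \<star> z)"
    and EF_HF: "z \<in> Mor K \<Longrightarrow> trg K z = X \<Longrightarrow> EF (f \<star> z) \<cdot> (f \<rhd> HF z) = \<i> (f \<star> z)"
      "z \<in> Mor K \<Longrightarrow> trg K z = A \<Longrightarrow> (g \<rhd> EF z) \<cdot> HF (g \<star> z) = \<i> (g \<star> z)"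
    and PJ_PI: "z \<in> Mor K \<Longrightarrow> trg K z = A \<Longrightarrow> PJ z \<cdot> PI z = \<i> (g \<star> s \<star> z)"
      "z \<in> Mor K \<Longrightarrow> trg K z = A \<Longrightarrow> PI z \<cdot> PJ z = \<i> (t \<star> u \<star> z)"
    and BB_def: "z \<in> Mor K \<Longrightarrow> trg K z = A \<Longrightarrow> BB z = PI z \<cdot> (g \<rhd> HS z)"
    and AA_def: "z \<in> Mor K \<Longrightarrow> trg K z = A \<Longrightarrow> AA z = PJ z \<cdot> HT (u \<star> z)"
    and UU_def: "z \<in> Mor K \<Longrightarrow> trg K z = A \<Longrightarrow> UU z = PI z \<cdot> (g \<rhd> MS z) \<cdot> AA (s \<star> z)"
    and PS_def: "z \<in> Mor K \<Longrightarrow> trg K z = A \<Longrightarrow> PS z = PJ z \<cdot> MT (u \<star> z) \<cdot> (t \<rhd> BB z)"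
begin

lemma hom_simps [simp]:
  "f \<in> Mor K" "src K f = X" "trg K f = A" "g \<in> Mor K" "src K g = A" "trg K g = X"
  "s \<in> Mor K" "src K s = A" "trg K s = A" "t \<in> Mor K" "src K t = X" "trg K t = X"
  "u \<in> Mor K" "src K u = A" "trg K u = X"
  using homs by (auto simp: hom_iff)

lemmas core_families = HS MS HT MT HF EF PI PJ BB AA UU PS

lemmas family_typing [simp] = core_families[THEN strictifiesD(8), simplified] core_families[THEN strictifiesD(9), simplified]
  core_families[THEN strictifiesD(10), simplified]
  core_families[THEN strictifiesD(3)] core_families[THEN strictifiesD(4), simplified] core_families[THEN strictifiesD(5), simplified]

lemmas HS_nat = strict_naturality(1)[OF HS, simplified]
lemmas HT_nat = strict_naturality(1)[OF HT, simplified]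
lemmas HF_nat = strict_naturality(1)[OF HF, simplified]
lemmas MS_nat = strict_naturality[OF MS, simplified]
lemmas MT_nat = strict_naturality[OF MT, simplified]
lemmas EF_nat = strict_naturality[OF EF, simplified]
lemmas PI_nat = strict_naturality[OF PI, simplified]
lemmas PJ_nat = strict_naturality[OF PJ, simplified]
lemmas BB_nat = strict_naturality[OF BB, simplified]
lemmas AA_nat = strict_naturality[OF AA, simplified]
lemmas UU_nat = strict_naturality[OF UU, simplified]
lemmas PS_nat = strict_naturality[OF PS, simplified]
lemmas natural = HS_nat HT_nat HF_nat MS_nat MT_nat EF_nat PI_nat PJ_nat BB_nat AA_nat UU_nat PS_nat

lemma laws_tail:
  assumes "z \<in> Mor K" "k \<in> Cell K"
  shows "trg K z = A \<Longrightarrow> vcod K k = s \<star> s \<star> s \<star> z \<Longrightarrow> MS z \<cdot> (s \<rhd> MS z) \<cdot> k = MS z \<cdot> MS (s \<star> z) \<cdot> k"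
  "trg K z = A \<Longrightarrow> vcod K k = s \<star> z \<Longrightarrow> MS z \<cdot> HS (s \<star> z) \<cdot> k = k"
  "trg K z = A \<Longrightarrow> vcod K k = s \<star> z \<Longrightarrow> MS z \<cdot> (s \<rhd> HS z) \<cdot> k = k"
  "trg K z = X \<Longrightarrow> vcod K k = t \<star> t \<star> t \<star> z \<Longrightarrow> MT z \<cdot> (t \<rhd> MT z) \<cdot> k = MT z \<cdot> MT (t \<star> z) \<cdot> k"
  "trg K z = X \<Longrightarrow> vcod K k = t \<star> z \<Longrightarrow> MT z \<cdot> HT (t \<star> z) \<cdot> k = k"
  "trg K z = X \<Longrightarrow> vcod K k = t \<star> z \<Longrightarrow> MT z \<cdot> (t \<rhd> HT z) \<cdot> k = k"
  "trg K z = X \<Longrightarrow> vcod K k = f \<star> z \<Longrightarrow> EF (f \<star> z) \<cdot> (f \<rhd> HF z) \<cdot> k = k"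
  "trg K z = A \<Longrightarrow> vcod K k = g \<star> z \<Longrightarrow> (g \<rhd> EF z) \<cdot> HF (g \<star> z) \<cdot> k = k"
  "trg K z = A \<Longrightarrow> vcod K k = g \<star> s \<star> z \<Longrightarrow> PJ z \<cdot> PI z \<cdot> k = k"
  "trg K z = A \<Longrightarrow> vcod K k = t \<star> u \<star> z \<Longrightarrow> PI z \<cdot> PJ z \<cdot> k = k"
  using assms vcomp_tail[OF MS_assoc, of z k] vcomp_tail[OF MS_HS(1), of z k] vcomp_tail[OF MS_HS(2), of z k]
    vcomp_tail[OF MT_assoc, of z k] vcomp_tail[OF MT_HT(1), of z k] vcomp_tail[OF MT_HT(2), of z k]
   vcomp_tail[OF EF_HF(1), of z k] vcomp_tail[OF EF_HF(2), of z k] vcomp_tail[OF PJ_PI(1), of z k]  vcomp_tail[OF PJ_PI(2), of z k]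
  by simp_all

lemmas laws = MS_assoc MS_HS MT_assoc MT_HT EF_HF PJ_PI laws_tail

definition cond_I where "cond_I \<longleftrightarrow> (\<forall>z. z \<in> Mor K \<and> trg K z = A \<longrightarrow>
    MT (u \<star> z) \<cdot> (t \<rhd> UU z) \<cdot> PI (s \<star> z) = PI z \<cdot> (g \<rhd> MS z))"
definition cond_II where "cond_II \<longleftrightarrow> (\<forall>z. z \<in> Mor K \<and> trg K z = A \<longrightarrow>
    (g \<rhd> MS z) \<cdot> PS (s \<star> z) \<cdot> (t \<rhd> PJ z) = PJ z \<cdot> MT (u \<star> z))"
text \<open>
  The right action \<open>g\<mu>\<close> on \<open>gs\<close> commutes with the left action \<open>\<pi>\<^sup>-\<^sup>1 \<cdot> \<mu>u \<cdot> t\<pi>\<close> transported from \<open>tu\<close>.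
\<close>

definition bimodule where "bimodule \<longleftrightarrow> (\<forall>z. z \<in> Mor K \<and> trg K z = A \<longrightarrow>
    (g \<rhd> MS z) \<cdot> PJ (s \<star> z) \<cdot> MT (u \<star> s \<star> z) \<cdot> (t \<rhd> PI (s \<star> z))
     = PJ z \<cdot> MT (u \<star> z) \<cdot> (t \<rhd> PI z) \<cdot> (t \<rhd> g \<rhd> MS z))"

lemma whisker2: "a \<cdot> b = c \<Longrightarrow> b \<in> Cell K \<Longrightarrow> a \<in> Cell K \<Longrightarrow> vcod K b = vdom K a \<Longrightarrow> p \<in> Mor K \<Longrightarrow> src K p = trg K (vdom K b)
   \<Longrightarrow> (p \<rhd> a) \<cdot> (p \<rhd> b) = p \<rhd> c"
  by (metis whisker_simps(2))

text \<open>
  Under (I) the right action on \<open>tu\<close> is \<open>\<mu>u \<cdot> t\<upsilon>\<close>, and a map of this form is \<open>t\<close>-linear by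
  associativity of \<open>\<mu>\<close>.
\<close>

lemma cond_I_bimodule: assumes I: cond_I shows bimodule
  unfolding bimodule_def
proof (intro allI impI; elim conjE)
  fix z assume [simp]: "z \<in> Mor K" "trg K z = A"
  have I: "PI z \<cdot> (g \<rhd> MS z) = MT (u \<star> z) \<cdot> (t \<rhd> UU z) \<cdot> PI (s \<star> z)"
    using I by (simp add: cond_I_def)
  have I': "g \<rhd> MS z = PJ z \<cdot> MT (u \<star> z) \<cdot> (t \<rhd> UU z) \<cdot> PI (s \<star> z)"
    by (simp add: laws flip: I)
  have tI: "(t \<rhd> PI z) \<cdot> (t \<rhd> g \<rhd> MS z) = (t \<rhd> MT (u \<star> z)) \<cdot> (t \<rhd> t \<rhd> UU z) \<cdot> (t \<rhd> PI (s \<star> z))"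
    using whisker2[OF I, of t] by simp
  show "(g \<rhd> MS z) \<cdot> PJ (s \<star> z) \<cdot> MT (u \<star> s \<star> z) \<cdot> (t \<rhd> PI (s \<star> z))
     = PJ z \<cdot> MT (u \<star> z) \<cdot> (t \<rhd> PI z) \<cdot> (t \<rhd> g \<rhd> MS z)"
    unfolding tI unfolding I' by (simp add: laws natural)
qed

text \<open>
  The mirror image: under (II) the left action on \<open>gs\<close> is \<open>g\<mu> \<cdot> \<psi>s\<close>, which is \<open>s\<close>-linear.
\<close>

lemma cond_II_bimodule: assumes II: cond_II shows bimodule
  unfolding bimodule_def
proof (intro allI impI; elim conjE)
  fix z assume [simp]: "z \<in> Mor K" "trg K z = A"
  have II: "PJ y \<cdot> MT (u \<star> y) = (g \<rhd> MS y) \<cdot> PS (s \<star> y) \<cdot> (t \<rhd> PJ y)" 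
    if "y \<in> Mor K" "trg K y = A" for y
    using II that by (simp add: cond_II_def)
  have PJPI: "(t \<rhd> PJ y) \<cdot> (t \<rhd> PI y) = \<i> (t \<star> g \<star> s \<star> y)" if "y \<in> Mor K" "trg K y = A" for y
    using whisker2[OF PJ_PI(1), of y t] that by simp
  have gMS: "(g \<rhd> MS z) \<cdot> (g \<rhd> s \<rhd> MS z) = (g \<rhd> MS z) \<cdot> (g \<rhd> MS (s \<star> z))"
    using whisker2[OF MS_assoc, of z g] by simp
  have "(g \<rhd> MS z) \<cdot> PJ (s \<star> z) \<cdot> MT (u \<star> s \<star> z) \<cdot> (t \<rhd> PI (s \<star> z))
     = (g \<rhd> MS z) \<cdot> (g \<rhd> MS (s \<star> z)) \<cdot> PS (s \<star> s \<star> z)"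
    using vcomp_tail[OF II[of "s \<star> z"], of "t \<rhd> PI (s \<star> z)"] by (simp add: PJPI)
  also have "\<dots> = (g \<rhd> MS z) \<cdot> (g \<rhd> s \<rhd> MS z) \<cdot> PS (s \<star> s \<star> z)"
    by (simp add: vcomp_tail[OF gMS])
  also have "\<dots> = (g \<rhd> MS z) \<cdot> PS (s \<star> z) \<cdot> (t \<rhd> g \<rhd> MS z)"
    by (simp add: natural)
  also have "\<dots> = PJ z \<cdot> MT (u \<star> z) \<cdot> (t \<rhd> PI z) \<cdot> (t \<rhd> g \<rhd> MS z)"
    by (simp add: vcomp_tail[OF II[of z]] vcomp_tail[OF PJPI])
  finally show "(g \<rhd> MS z) \<cdot> PJ (s \<star> z) \<cdot> MT (u \<star> s \<star> z) \<cdot> (t \<rhd> PI (s \<star> z))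
     = PJ z \<cdot> MT (u \<star> z) \<cdot> (t \<rhd> PI z) \<cdot> (t \<rhd> g \<rhd> MS z)" .
qed

text \<open>
  A \<open>t\<close>-linear map out of \<open>tu\<close> is determined by its restriction along \<open>\<eta>u\<close>, and \<open>\<upsilon>\<close> is by definition
  this restriction of the right action.
\<close>

lemma bimodule_cond_I: assumes bimodule shows cond_I
  unfolding cond_I_def
proof (intro allI impI; elim conjE)
  fix z assume [simp]: "z \<in> Mor K" "trg K z = A"
  have bi: "PJ z \<cdot> MT (u \<star> z) \<cdot> (t \<rhd> PI z) \<cdot> (t \<rhd> g \<rhd> MS z) = (g \<rhd> MS z) \<cdot> PJ (s \<star> z) \<cdot> MT (u \<star> s \<star> z) \<cdot> (t \<rhd> PI (s \<star> z))"
    using assms by (simp add: bimodule_def)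
  have bi: "MT (u \<star> z) \<cdot> (t \<rhd> PI z) \<cdot> (t \<rhd> g \<rhd> MS z) = PI z \<cdot> (g \<rhd> MS z) \<cdot> PJ (s \<star> z) \<cdot> MT (u \<star> s \<star> z) \<cdot> (t \<rhd> PI (s \<star> z))"
    by (simp add: laws flip: bi)
  have PA: "(t \<rhd> PI (s \<star> z)) \<cdot> (t \<rhd> AA (s \<star> z)) = (t \<rhd> HT (u \<star> s \<star> z))"
    by (simp add: AA_def laws flip: whisker_simps(2))
  have "MT (u \<star> z) \<cdot> (t \<rhd> UU z) \<cdot> PI (s \<star> z) = 
    (MT (u \<star> z) \<cdot> (t \<rhd> PI z) \<cdot> (t \<rhd> g \<rhd> MS z)) \<cdot> (t \<rhd> AA (s \<star> z)) \<cdot> PI (s \<star> z)"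
    by (simp add: UU_def)
  also have "\<dots> = PI z \<cdot> (g \<rhd> MS z)"
    unfolding bi by (simp add: vcomp_tail[OF PA] laws)
  finally show "MT (u \<star> z) \<cdot> (t \<rhd> UU z) \<cdot> PI (s \<star> z) = PI z \<cdot> (g \<rhd> MS z)" .
qed

text \<open>
  Likewise an \<open>s\<close>-linear map out of \<open>gs\<close> is determined by its restriction along \<open>g\<eta>\<close>.
\<close>

lemma bimodule_cond_II: assumes bimodule shows cond_II
  unfolding cond_II_def
proof (intro allI impI; elim conjE)
  fix z assume [simp]: "z \<in> Mor K" "trg K z = A"
  have bi: "(g \<rhd> MS z) \<cdot> PJ (s \<star> z) \<cdot> MT (u \<star> s \<star> z) \<cdot> (t \<rhd> PI (s \<star> z)) = PJ z \<cdot> MT (u \<star> z) \<cdot> (t \<rhd> PI z) \<cdot> (t \<rhd> g \<rhd> MS z)"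
    using assms by (simp add: bimodule_def)
  have MH: "(t \<rhd> g \<rhd> MS z) \<cdot> (t \<rhd> g \<rhd> HS (s \<star> z)) = \<i> (t \<star> g \<star> s \<star> z)"
    by (simp add: laws flip: whisker_simps(2))
  have PP: "(t \<rhd> PI z) \<cdot> (t \<rhd> PJ z) = \<i> (t \<star> t \<star> u \<star> z)"
    by (simp add: laws flip: whisker_simps(2))
  have "(g \<rhd> MS z) \<cdot> PS (s \<star> z) \<cdot> (t \<rhd> PJ z) = 
    ((g \<rhd> MS z) \<cdot> PJ (s \<star> z) \<cdot> MT (u \<star> s \<star> z) \<cdot> (t \<rhd> PI (s \<star> z))) \<cdot> (t \<rhd> g \<rhd> HS (s \<star> z)) \<cdot> (t \<rhd> PJ z)"
    by (simp add: PS_def BB_def)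
  also have "\<dots> = PJ z \<cdot> MT (u \<star> z)"
    unfolding bi by (simp add: vcomp_tail[OF MH] PP)
  finally show "(g \<rhd> MS z) \<cdot> PS (s \<star> z) \<cdot> (t \<rhd> PJ z) = PJ z \<cdot> MT (u \<star> z)" .
qed

end

section \<open>Necessity and uniqueness\<close>

text \<open>
  Candidate data \<open>\<phi>\<close>, \<open>\<upsilon>'\<close>, \<open>\<alpha>\<close>, \<open>\<beta>\<close> for an adjunction in \<open>KL(K)\<close>, with families \<open>Ph\<close>, \<open>Up\<close>, \<open>Al\<close>, \<open>Be\<close>.
\<close>

locale kl_data = strict_core K A X f g s t u \<eta>\<^sub>s \<mu>\<^sub>s \<eta>\<^sub>t \<mu>\<^sub>t \<eta>\<^sub>f \<epsilon>\<^sub>f \<pi> \<beta>' \<alpha>' \<upsilon> \<psi>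
    HS MS HT MT HF EF PI PJ BB AA UU PS
  for K :: "('o, 'm, 'c) bicat" (structure) and A X f g s t u \<eta>\<^sub>s \<mu>\<^sub>s \<eta>\<^sub>t \<mu>\<^sub>t \<eta>\<^sub>f \<epsilon>\<^sub>f \<pi> \<beta>' \<alpha>' \<upsilon> \<psi>
    HS MS HT MT HF EF PI PJ BB AA UU PS +
  fixes \<phi> \<upsilon>' \<alpha> \<beta> :: 'c and Ph Up Al Be :: "'m \<Rightarrow> 'c"
  assumes Ph: "strictifies (Gen f \<bullet> Gen t) (Gen s \<bullet> Gen f) \<phi> Ph"
    and Up: "strictifies (Gen u \<bullet> Gen s) (Gen t \<bullet> Gen u) \<upsilon>' Up"
    and Al: "strictifies (Gen f \<bullet> Gen u) (Gen s) \<alpha> Al"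
    and Be: "strictifies (Unit X) (Gen t \<bullet> Gen u \<bullet> Gen f) \<beta> Be"
begin

lemmas kl_families = Ph Up Al Be
lemmas kl_typing [simp] = kl_families[THEN strictifiesD(8), simplified] kl_families[THEN strictifiesD(9), simplified]
  kl_families[THEN strictifiesD(10), simplified]
  kl_families[THEN strictifiesD(3)] kl_families[THEN strictifiesD(4), simplified] kl_families[THEN strictifiesD(5), simplified]
lemmas Be_nat = strict_naturality(1)[OF Be, simplified]
lemmas Ph_nat = strict_naturality[OF Ph, simplified]

text \<open>
  In order: \<open>\<upsilon>'\<close> and \<open>\<phi>\<close> are monad opmorphisms, \<open>\<alpha>\<close> and \<open>\<beta>\<close> are Kleisli cells, the two triangle
  identities hold, and the associated core is \<open>\<pi>\<close>.
\<close>

definition equations where "equations \<longleftrightarrow>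
  (\<forall>z. z \<in> Mor K \<and> trg K z = A \<longrightarrow> MT (u \<star> z) \<cdot> (t \<rhd> Up z) \<cdot> Up (s \<star> z) = Up z \<cdot> (u \<rhd> MS z)) \<and>
  (\<forall>z. z \<in> Mor K \<and> trg K z = A \<longrightarrow> Up z \<cdot> (u \<rhd> HS z) = HT (u \<star> z)) \<and>
  (\<forall>z. z \<in> Mor K \<and> trg K z = X \<longrightarrow> MS (f \<star> z) \<cdot> (s \<rhd> Ph z) \<cdot> Ph (t \<star> z) = Ph z \<cdot> (f \<rhd> MT z)) \<and>
  (\<forall>z. z \<in> Mor K \<and> trg K z = X \<longrightarrow> Ph z \<cdot> (f \<rhd> HT z) = HS (f \<star> z)) \<and>
  (\<forall>z. z \<in> Mor K \<and> trg K z = A \<longrightarrow> MS z \<cdot> Al (s \<star> z) = MS z \<cdot> (s \<rhd> Al z) \<cdot> Ph (u \<star> z) \<cdot> (f \<rhd> Up z)) \<and>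
  (\<forall>z. z \<in> Mor K \<and> trg K z = X \<longrightarrow> MT (u \<star> f \<star> z) \<cdot> (t \<rhd> Be z)
     = MT (u \<star> f \<star> z) \<cdot> (t \<rhd> Up (f \<star> z)) \<cdot> (t \<rhd> u \<rhd> Ph z) \<cdot> Be (t \<star> z)) \<and>
  (\<forall>z. z \<in> Mor K \<and> trg K z = X \<longrightarrow> HS (f \<star> z)
     = MS (f \<star> z) \<cdot> (s \<rhd> Al (f \<star> z)) \<cdot> Ph (u \<star> f \<star> z) \<cdot> (f \<rhd> Be z)) \<and>
  (\<forall>z. z \<in> Mor K \<and> trg K z = A \<longrightarrow> HT (u \<star> z)
     = MT (u \<star> z) \<cdot> (t \<rhd> Up z) \<cdot> (t \<rhd> u \<rhd> Al z) \<cdot> Be (u \<star> z)) \<and>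
  (\<forall>z. z \<in> Mor K \<and> trg K z = A \<longrightarrow>
     MT (u \<star> z) \<cdot> (t \<rhd> Up z) \<cdot> (t \<rhd> u \<rhd> EF (s \<star> z)) \<cdot> Be (g \<star> s \<star> z) = PI z)"

lemma whiskered_EF_HF:
  assumes "z \<in> Mor K" "trg K z = X" "p \<in> Mor K" "src K p = A"
  shows "(p \<rhd> EF (f \<star> z)) \<cdot> (p \<rhd> f \<rhd> HF z) = \<i> (p \<star> f \<star> z)"
  using whisker2[OF EF_HF(1), of z p] assms by simp

context
  assumes eqs: equations
begin

lemma
  assumes "z \<in> Mor K"
  shows Up_mult: "trg K z = A \<Longrightarrow> MT (u \<star> z) \<cdot> (t \<rhd> Up z) \<cdot> Up (s \<star> z) = Up z \<cdot> (u \<rhd> MS z)"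
    and Up_unit: "trg K z = A \<Longrightarrow> Up z \<cdot> (u \<rhd> HS z) = HT (u \<star> z)"
    and Al_cell: "trg K z = A \<Longrightarrow> MS z \<cdot> Al (s \<star> z) = MS z \<cdot> (s \<rhd> Al z) \<cdot> Ph (u \<star> z) \<cdot> (f \<rhd> Up z)"
    and Be_cell: "trg K z = X \<Longrightarrow>
      MT (u \<star> f \<star> z) \<cdot> (t \<rhd> Up (f \<star> z)) \<cdot> (t \<rhd> u \<rhd> Ph z) \<cdot> Be (t \<star> z) = MT (u \<star> f \<star> z) \<cdot> (t \<rhd> Be z)"
    and triangle_Up: "trg K z = A \<Longrightarrow> MT (u \<star> z) \<cdot> (t \<rhd> Up z) \<cdot> (t \<rhd> u \<rhd> Al z) \<cdot> Be (u \<star> z) = HT (u \<star> z)"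
    and PI_core: "trg K z = A \<Longrightarrow> PI z = MT (u \<star> z) \<cdot> (t \<rhd> Up z) \<cdot> (t \<rhd> u \<rhd> EF (s \<star> z)) \<cdot> Be (g \<star> s \<star> z)"
  using eqs assms unfolding equations_def by auto

text \<open>
  Since \<open>\<pi>\<close> is built from \<open>\<beta>\<close> and \<open>\<epsilon>\<close>, naturality of these two moves any cell \<open>gx\<close> past them.
\<close>

lemma PI_whisker:
  assumes [simp]: "x \<in> Cell K" "vcod K x = s \<star> z" "z \<in> Mor K" "trg K z = A"
  shows "PI z \<cdot> (g \<rhd> x) = MT (u \<star> z) \<cdot> (t \<rhd> Up z) \<cdot> (t \<rhd> u \<rhd> x) \<cdot> (t \<rhd> u \<rhd> EF (vdom K x)) \<cdot> Be (g \<star> vdom K x)"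
proof -
  have [simp]: "trg K (vdom K x) = A" using cell_typing(4)[of x] by simp
  have w: "(t \<rhd> u \<rhd> EF (s \<star> z)) \<cdot> (t \<rhd> u \<rhd> f \<rhd> g \<rhd> x) = (t \<rhd> u \<rhd> x) \<cdot> (t \<rhd> u \<rhd> EF (vdom K x))"
    by (simp add: EF_nat flip: whisker_simps(2))
  show ?thesis by (simp add: PI_core Be_nat vcomp_tail[OF w])
qed

text \<open>
  Composing the mate of \<open>x : fy \<Rightarrow> sz\<close> with \<open>\<pi>\<close> is the Kleisli composite of \<open>u\<close> applied to \<open>x\<close> with
  the unit \<open>\<beta>\<close>, that is, its transpose under the adjunction in \<open>KL(K)\<close>.
\<close>

lemma PI_mate:
  assumes [simp]: "x \<in> Cell K" "vdom K x = f \<star> y" "vcod K x = s \<star> z" "y \<in> Mor K" "trg K y = X" "z \<in> Mor K" "trg K z = A"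
  shows "PI z \<cdot> (g \<rhd> x) \<cdot> HF y = MT (u \<star> z) \<cdot> (t \<rhd> Up z) \<cdot> (t \<rhd> u \<rhd> x) \<cdot> Be y"
proof -
  have w: "(t \<rhd> u \<rhd> EF (f \<star> y)) \<cdot> (t \<rhd> u \<rhd> f \<rhd> HF y) = \<i> (t \<star> u \<star> f \<star> y)"
    using whisker2[OF whiskered_EF_HF[of y u], of t] by simp
  have "PI z \<cdot> (g \<rhd> x) \<cdot> HF y = (PI z \<cdot> (g \<rhd> x)) \<cdot> HF y" by simp
  also have "\<dots> = MT (u \<star> z) \<cdot> (t \<rhd> Up z) \<cdot> (t \<rhd> u \<rhd> x) \<cdot> Be y"
    unfolding PI_whisker[OF assms(1,3,6,7)] by (simp add: Be_nat vcomp_tail[OF w])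
  finally show ?thesis .
qed

text \<open>
  Multiplicativity of the opmorphism \<open>\<upsilon>'\<close> is what makes \<open>\<pi>\<close> compatible with the right actions.
\<close>

lemma PI_right_linear:
  assumes [simp]: "z \<in> Mor K" "trg K z = A"
  shows "MT (u \<star> z) \<cdot> (t \<rhd> Up z) \<cdot> PI (s \<star> z) = PI z \<cdot> (g \<rhd> MS z)"
proof -
  have w: "(t \<rhd> Up z) \<cdot> (t \<rhd> u \<rhd> MS z) = (t \<rhd> MT (u \<star> z)) \<cdot> (t \<rhd> t \<rhd> Up z) \<cdot> (t \<rhd> Up (s \<star> z))"
    using whisker2[OF Up_mult[symmetric], of z t] by simp
  have p: "PI z \<cdot> (g \<rhd> MS z)
      = MT (u \<star> z) \<cdot> (t \<rhd> Up z) \<cdot> (t \<rhd> u \<rhd> MS z) \<cdot> (t \<rhd> u \<rhd> EF (s \<star> s \<star> z)) \<cdot> Be (g \<star> s \<star> s \<star> z)"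
    using PI_whisker[of "MS z" z] by simp
  show ?thesis unfolding p by (simp add: vcomp_tail[OF w] PI_core laws natural)
qed

text \<open>
  The three formulas for the mates come from applying \<open>\<pi>\<close>: the unit law of \<open>\<upsilon>'\<close> gives the
  mate of \<open>\<beta>\<close>, the triangle identity at \<open>u\<close> that of \<open>\<alpha>\<close>, and the Kleisli cell equation for \<open>\<beta>\<close> that
  of \<open>\<phi>\<close>.
\<close>

lemma BB_mate:
  assumes [simp]: "z \<in> Mor K" "trg K z = A"
  shows "BB z = (t \<rhd> u \<rhd> EF z) \<cdot> Be (g \<star> z)"
proof -
  have w: "(t \<rhd> Up z) \<cdot> (t \<rhd> u \<rhd> HS z) = t \<rhd> HT (u \<star> z)"
    using whisker2[OF Up_unit, of z t] by simp
  show ?thesis by (simp add: BB_def PI_whisker vcomp_tail[OF w] laws)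
qed

lemma AA_mate:
  assumes [simp]: "z \<in> Mor K" "trg K z = A"
  shows "AA z = (g \<rhd> Al z) \<cdot> HF (u \<star> z)"
proof -
  have "AA z = PJ z \<cdot> PI z \<cdot> (g \<rhd> Al z) \<cdot> HF (u \<star> z)"
    by (simp add: AA_def PI_mate triangle_Up)
  then show ?thesis by (simp add: laws)
qed

lemma PI_Ph_mate:
  assumes [simp]: "y \<in> Mor K" "trg K y = X"
  shows "PI (f \<star> y) \<cdot> (g \<rhd> Ph y) \<cdot> HF (t \<star> y) = MT (u \<star> f \<star> y) \<cdot> (t \<rhd> Be y)"
  by (simp add: PI_mate Be_cell)

lemma PS_mate:
  assumes [simp]: "z \<in> Mor K" "trg K z = A"
  shows "PS z = (g \<rhd> s \<rhd> EF z) \<cdot> (g \<rhd> Ph (g \<star> z)) \<cdot> HF (t \<star> g \<star> z)"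
proof -
  have "PI z \<cdot> (g \<rhd> s \<rhd> EF z) \<cdot> (g \<rhd> Ph (g \<star> z)) \<cdot> HF (t \<star> g \<star> z) = MT (u \<star> z) \<cdot> (t \<rhd> BB z)"
    by (simp add: natural PI_Ph_mate BB_mate)
  then have "PS z = PJ z \<cdot> PI z \<cdot> (g \<rhd> s \<rhd> EF z) \<cdot> (g \<rhd> Ph (g \<star> z)) \<cdot> HF (t \<star> g \<star> z)"
    by (simp add: PS_def)
  then show ?thesis by (simp add: laws)
qed

text \<open>
  The Kleisli cell equation for \<open>\<alpha>\<close> writes \<open>g\<mu> \<cdot> \<alpha>'s\<close> as \<open>\<upsilon>'\<close> followed by a cell
  \<open>tu \<Rightarrow> gs\<close>.  That cell is a right inverse of \<open>\<pi>\<close>: linearity of \<open>\<pi>\<close> and the Kleisli cell equation for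
  \<open>\<beta>\<close> turn its composite with \<open>\<pi>\<close> into the triangle identity at \<open>u\<close>.
\<close>

lemma Up_eq_UU:
  assumes [simp]: "z \<in> Mor K" "trg K z = A"
  shows "Up z = UU z"
proof -
  have w: "(g \<rhd> MS z) \<cdot> (g \<rhd> Al (s \<star> z)) = (g \<rhd> MS z) \<cdot> (g \<rhd> s \<rhd> Al z) \<cdot> (g \<rhd> Ph (u \<star> z)) \<cdot> (g \<rhd> f \<rhd> Up z)"
    using whisker2[OF Al_cell, of z g] by simp
  (* naturality of the unit is used against its rewriting direction *)
  have n: "(g \<rhd> f \<rhd> Up z) \<cdot> HF (u \<star> s \<star> z) = HF (t \<star> u \<star> z) \<cdot> Up z"
    by (simp add: HF_nat)
  have k: "(t \<rhd> MT (u \<star> z)) \<cdot> (t \<rhd> t \<rhd> Up z) \<cdot> (t \<rhd> t \<rhd> u \<rhd> Al z) \<cdot> (t \<rhd> Be (u \<star> z)) = t \<rhd> HT (u \<star> z)"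
    using arg_cong[OF triangle_Up, of z "\<lambda>x. t \<rhd> x"] by simp
  have "PI z \<cdot> (g \<rhd> MS z) \<cdot> (g \<rhd> s \<rhd> Al z) \<cdot> (g \<rhd> Ph (u \<star> z)) \<cdot> HF (t \<star> u \<star> z)
    = MT (u \<star> z) \<cdot> (t \<rhd> Up z) \<cdot> PI (s \<star> z) \<cdot> (g \<rhd> s \<rhd> Al z) \<cdot> (g \<rhd> Ph (u \<star> z)) \<cdot> HF (t \<star> u \<star> z)"
    by (simp add: vcomp_tail[OF PI_right_linear[symmetric]])
  also have "\<dots> = MT (u \<star> z) \<cdot> (t \<rhd> Up z) \<cdot> (t \<rhd> u \<rhd> Al z) \<cdot> MT (u \<star> f \<star> u \<star> z) \<cdot> (t \<rhd> Be (u \<star> z))"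
    by (simp add: natural PI_Ph_mate)
  also have "\<dots> = MT (u \<star> z) \<cdot> (t \<rhd> MT (u \<star> z)) \<cdot> (t \<rhd> t \<rhd> Up z) \<cdot> (t \<rhd> t \<rhd> u \<rhd> Al z) \<cdot> (t \<rhd> Be (u \<star> z))"
    by (simp add: laws natural)
  also have "\<dots> = \<i> (t \<star> u \<star> z)" unfolding k by (simp add: laws)
  finally have id: "PI z \<cdot> (g \<rhd> MS z) \<cdot> (g \<rhd> s \<rhd> Al z) \<cdot> (g \<rhd> Ph (u \<star> z)) \<cdot> HF (t \<star> u \<star> z) = \<i> (t \<star> u \<star> z)" .
  have "UU z = PI z \<cdot> (g \<rhd> MS z) \<cdot> (g \<rhd> s \<rhd> Al z) \<cdot> (g \<rhd> Ph (u \<star> z)) \<cdot> ((g \<rhd> f \<rhd> Up z) \<cdot> HF (u \<star> s \<star> z))"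
    by (simp add: UU_def AA_mate vcomp_tail[OF w])
  also have "\<dots> = (PI z \<cdot> (g \<rhd> MS z) \<cdot> (g \<rhd> s \<rhd> Al z) \<cdot> (g \<rhd> Ph (u \<star> z)) \<cdot> HF (t \<star> u \<star> z)) \<cdot> Up z"
    unfolding n by simp
  also have "\<dots> = Up z" unfolding id by simp
  finally show ?thesis ..
qed

lemma equations_cond_I: cond_I
  unfolding cond_I_def using PI_right_linear Up_eq_UU by simp

text \<open>
  Passing to mates loses no information, because of the triangle identities of \<open>f \<stileturn> g\<close>; so the
  formulas for the mates determine \<open>\<alpha>\<close>, \<open>\<beta>\<close> and \<open>\<phi>\<close>.
\<close>

lemma Al_determined:
  assumes [simp]: "z \<in> Mor K" "trg K z = A"
  shows "Al z = EF (s \<star> z) \<cdot> (f \<rhd> AA z)"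
  by (simp add: AA_mate natural laws)

lemma Be_determined:
  assumes [simp]: "z \<in> Mor K" "trg K z = X"
  shows "Be z = BB (f \<star> z) \<cdot> HF z"
proof -
  have w: "(t \<rhd> u \<rhd> EF (f \<star> z)) \<cdot> (t \<rhd> u \<rhd> f \<rhd> HF z) = \<i> (t \<star> u \<star> f \<star> z)"
    using whisker2[OF whiskered_EF_HF[of z u], of t] by simp
  show ?thesis by (simp add: BB_mate Be_nat vcomp_tail[OF w])
qed

lemma Ph_determined:
  assumes [simp]: "z \<in> Mor K" "trg K z = X"
  shows "Ph z = EF (s \<star> f \<star> z) \<cdot> (f \<rhd> PS (f \<star> z)) \<cdot> (f \<rhd> t \<rhd> HF z)"
  by (simp add: PS_mate natural laws Ph_nat vcomp_tail[OF whiskered_EF_HF])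

end

end

section \<open>Sufficiency\<close>

context kl_data
begin

context
  assumes I: cond_I and II: cond_II
    and Up_def: "\<And>z. z \<in> Mor K \<Longrightarrow> trg K z = A \<Longrightarrow> Up z = UU z"
    and Al_def: "\<And>z. z \<in> Mor K \<Longrightarrow> trg K z = A \<Longrightarrow> Al z = EF (s \<star> z) \<cdot> (f \<rhd> AA z)"
    and Be_def: "\<And>z. z \<in> Mor K \<Longrightarrow> trg K z = X \<Longrightarrow> Be z = BB (f \<star> z) \<cdot> HF z"
    and Ph_def: "\<And>z. z \<in> Mor K \<Longrightarrow> trg K z = X \<Longrightarrow>
      Ph z = EF (s \<star> f \<star> z) \<cdot> (f \<rhd> PS (f \<star> z)) \<cdot> (f \<rhd> t \<rhd> HF z)"
begin

lemma cond_ID: "z \<in> Mor K \<Longrightarrow> trg K z = A \<Longrightarrow> MT (u \<star> z) \<cdot> (t \<rhd> UU z) \<cdot> PI (s \<star> z) = PI z \<cdot> (g \<rhd> MS z)"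
  using I by (simp add: cond_I_def)

lemma cond_IID: "z \<in> Mor K \<Longrightarrow> trg K z = A \<Longrightarrow> (g \<rhd> MS z) \<cdot> PS (s \<star> z) \<cdot> (t \<rhd> PJ z) = PJ z \<cdot> MT (u \<star> z)"
  using II by (simp add: cond_II_def)

text \<open>
  Restricting (I) along \<open>g\<eta>\<close> expresses \<open>\<pi>\<close>, and restricting (II) along \<open>t\<eta>u\<close> expresses its inverse,
  through the cells \<open>\<upsilon>\<close>, \<open>\<beta>'\<close> and \<open>\<psi>\<close>, \<open>\<alpha>'\<close> that enter the adjunction.
\<close>

lemma PI_from_UU:
  assumes [simp]: "z \<in> Mor K" "trg K z = A"
  shows "MT (u \<star> z) \<cdot> (t \<rhd> UU z) \<cdot> BB (s \<star> z) = PI z"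
proof -
  have w: "(g \<rhd> MS z) \<cdot> (g \<rhd> HS (s \<star> z)) = \<i> (g \<star> s \<star> z)"
    by (simp add: laws flip: whisker_simps(2))
  show ?thesis by (simp add: BB_def vcomp_tail3[OF cond_ID] w)
qed

lemma PJ_from_PS:
  assumes [simp]: "z \<in> Mor K" "trg K z = A"
  shows "(g \<rhd> MS z) \<cdot> PS (s \<star> z) \<cdot> (t \<rhd> AA z) = PJ z"
  by (simp add: AA_def vcomp_tail3[OF cond_IID] laws)

text \<open>
  These two laws for \<open>\<psi> : tg \<Rightarrow> gs\<close> are the mates of the opmorphism laws of \<open>\<phi>\<close>.
\<close>

lemma PS_unit:
  assumes [simp]: "z \<in> Mor K" "trg K z = A"
  shows "PS z \<cdot> HT (g \<star> z) = g \<rhd> HS z"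
proof -
  have "(t \<rhd> BB z) \<cdot> HT (g \<star> z) = HT (t \<star> u \<star> z) \<cdot> BB z" by (simp add: natural)
  then have "PS z \<cdot> HT (g \<star> z) = PJ z \<cdot> MT (u \<star> z) \<cdot> HT (t \<star> u \<star> z) \<cdot> BB z" by (simp add: PS_def)
  then show ?thesis by (simp add: laws BB_def)
qed

lemma PS_mult:
  assumes [simp]: "z \<in> Mor K" "trg K z = A"
  shows "(g \<rhd> MS z) \<cdot> PS (s \<star> z) \<cdot> (t \<rhd> PS z) = PS z \<cdot> MT (g \<star> z)"
proof -
  have p: "t \<rhd> PS z = (t \<rhd> PJ z) \<cdot> (t \<rhd> MT (u \<star> z)) \<cdot> (t \<rhd> t \<rhd> BB z)"
    using arg_cong[OF PS_def, of z "\<lambda>x. t \<rhd> x"] by simp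
  have "(g \<rhd> MS z) \<cdot> PS (s \<star> z) \<cdot> (t \<rhd> PS z) = PJ z \<cdot> MT (u \<star> z) \<cdot> (t \<rhd> MT (u \<star> z)) \<cdot> (t \<rhd> t \<rhd> BB z)"
    unfolding p by (simp add: vcomp_tail3[OF cond_IID])
  also have "\<dots> = PS z \<cdot> MT (g \<star> z)" by (simp add: PS_def laws natural)
  finally show ?thesis .
qed

text \<open>
  A cell with values in some \<open>gw\<close> can be carried through the unit \<open>\<beta>\<close>, at the price of
  replacing \<open>\<beta>\<close> by its mate; this reduces the equations that involve \<open>\<beta>\<close> to equations about \<open>\<beta>'\<close>.
\<close>

lemma Be_mate:
  assumes [simp]: "x \<in> Cell K" "vcod K x = g \<star> w" "w \<in> Mor K" "trg K w = A" and [simp]: "vdom K x = y"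
  shows "(t \<rhd> u \<rhd> EF w) \<cdot> (t \<rhd> u \<rhd> f \<rhd> x) \<cdot> Be y = BB w \<cdot> x"
proof -
  have [simp]: "y \<in> Mor K" "trg K y = X"
    using cell_typing(1,4)[of x] by simp_all
  (* inserting a triangle identity creates the unit that turns the mate back into Be *)
  have "BB w \<cdot> x = BB w \<cdot> (g \<rhd> EF w) \<cdot> HF (g \<star> w) \<cdot> x" by (simp add: laws)
  also have "\<dots> = (t \<rhd> u \<rhd> EF w) \<cdot> BB (f \<star> g \<star> w) \<cdot> (HF (g \<star> w) \<cdot> x)" by (simp add: BB_nat)
  also have "\<dots> = (t \<rhd> u \<rhd> EF w) \<cdot> (t \<rhd> u \<rhd> f \<rhd> x) \<cdot> Be y" by (simp add: natural Be_def)
  finally show ?thesis ..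
qed

lemma Al_mate:
  assumes [simp]: "z \<in> Mor K" "trg K z = A"
  shows "(g \<rhd> Al z) \<cdot> HF (u \<star> z) = AA z"
proof -
  have n: "(g \<rhd> f \<rhd> AA z) \<cdot> HF (u \<star> z) = HF (g \<star> s \<star> z) \<cdot> AA z" by (simp add: HF_nat)
  show ?thesis by (simp add: Al_def n laws)
qed

lemma Ph_mate:
  assumes [simp]: "z \<in> Mor K" "trg K z = X"
  shows "(g \<rhd> Ph z) \<cdot> HF (t \<star> z) = PS (f \<star> z) \<cdot> (t \<rhd> HF z)"
proof -
  have n: "(g \<rhd> f \<rhd> PS (f \<star> z)) \<cdot> (g \<rhd> f \<rhd> t \<rhd> HF z) \<cdot> HF (t \<star> z)
    = HF (g \<star> s \<star> f \<star> z) \<cdot> PS (f \<star> z) \<cdot> (t \<rhd> HF z)" by (simp add: HF_nat)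
  show ?thesis by (simp add: Ph_def n laws)
qed

text \<open>
  The corresponding reduction for \<open>\<phi>\<close>: a cell \<open>x : fy \<Rightarrow> q\<close> applied after \<open>\<phi>\<close> is absorbed into a mate,
  where it meets \<open>\<psi>\<close>.
\<close>

lemma whisker_Ph:
  assumes [simp]: "x \<in> Cell K" "vdom K x = f \<star> y" "vcod K x = q" "y \<in> Mor K" "trg K y = X"
  shows "(s \<rhd> x) \<cdot> Ph y = EF (s \<star> q) \<cdot> (f \<rhd> PS q) \<cdot> (f \<rhd> t \<rhd> g \<rhd> x) \<cdot> (f \<rhd> t \<rhd> HF y)"
proof -
  have [simp]: "q \<in> Mor K" "trg K q = A"
    using cell_typing(2,4)[of x] by simp_all
  have w: "(f \<rhd> PS q) \<cdot> (f \<rhd> t \<rhd> g \<rhd> x) = (f \<rhd> g \<rhd> s \<rhd> x) \<cdot> (f \<rhd> PS (f \<star> y))"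
    by (simp add: PS_nat flip: whisker_simps(2))
  show ?thesis by (simp add: vcomp_tail[OF w] EF_nat Ph_def)
qed

text \<open>
  The Kleisli extension of \<open>\<alpha>\<close> along \<open>\<phi>\<close> is the mate of \<open>\<pi>\<^sup>-\<^sup>1\<close>; both equations that contain \<open>\<alpha>\<close>
  together with \<open>\<phi>\<close> follow from this.
\<close>

lemma counit_Ph:
  assumes [simp]: "z \<in> Mor K" "trg K z = A"
  shows "MS z \<cdot> (s \<rhd> Al z) \<cdot> Ph (u \<star> z) = EF (s \<star> z) \<cdot> (f \<rhd> PJ z)"
proof -
  have a: "(f \<rhd> t \<rhd> g \<rhd> Al z) \<cdot> (f \<rhd> t \<rhd> HF (u \<star> z)) = f \<rhd> t \<rhd> AA z"
    by (simp add: Al_mate flip: whisker_simps(2))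
  have p: "(f \<rhd> g \<rhd> MS z) \<cdot> (f \<rhd> PS (s \<star> z)) \<cdot> (f \<rhd> t \<rhd> AA z) = f \<rhd> PJ z"
    using arg_cong[OF PJ_from_PS, of z "\<lambda>x. f \<rhd> x"] by simp
  have "MS z \<cdot> (s \<rhd> Al z) \<cdot> Ph (u \<star> z) = MS z \<cdot> EF (s \<star> s \<star> z) \<cdot> (f \<rhd> PS (s \<star> z)) \<cdot> (f \<rhd> t \<rhd> AA z)"
    by (simp add: whisker_Ph a)
  also have "\<dots> = EF (s \<star> z) \<cdot> ((f \<rhd> g \<rhd> MS z) \<cdot> (f \<rhd> PS (s \<star> z)) \<cdot> (f \<rhd> t \<rhd> AA z))"
    by (simp add: EF_nat)
  also have "\<dots> = EF (s \<star> z) \<cdot> (f \<rhd> PJ z)" unfolding p ..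
  finally show ?thesis .
qed

lemma Up_opmorphism:
  assumes [simp]: "z \<in> Mor K" "trg K z = A"
  shows "MT (u \<star> z) \<cdot> (t \<rhd> UU z) \<cdot> UU (s \<star> z) = UU z \<cdot> (u \<rhd> MS z)"
    and "UU z \<cdot> (u \<rhd> HS z) = HT (u \<star> z)"
proof -
  have w1: "(g \<rhd> MS z) \<cdot> (g \<rhd> s \<rhd> MS z) = (g \<rhd> MS z) \<cdot> (g \<rhd> MS (s \<star> z))"
    by (simp add: laws flip: whisker_simps(2))
  have w2: "(g \<rhd> MS z) \<cdot> (g \<rhd> s \<rhd> HS z) = \<i> (g \<star> s \<star> z)"
    by (simp add: laws flip: whisker_simps(2))
  have "MT (u \<star> z) \<cdot> (t \<rhd> UU z) \<cdot> UU (s \<star> z)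
      = MT (u \<star> z) \<cdot> (t \<rhd> UU z) \<cdot> PI (s \<star> z) \<cdot> (g \<rhd> MS (s \<star> z)) \<cdot> AA (s \<star> s \<star> z)"
    by (simp add: UU_def[of "s \<star> z"])
  also have "\<dots> = PI z \<cdot> (g \<rhd> MS z) \<cdot> (g \<rhd> MS (s \<star> z)) \<cdot> AA (s \<star> s \<star> z)"
    by (simp add: vcomp_tail3[OF cond_ID])
  also have "\<dots> = UU z \<cdot> (u \<rhd> MS z)" by (simp add: UU_def AA_nat vcomp_tail[OF w1])
  finally show "MT (u \<star> z) \<cdot> (t \<rhd> UU z) \<cdot> UU (s \<star> z) = UU z \<cdot> (u \<rhd> MS z)" .
  show "UU z \<cdot> (u \<rhd> HS z) = HT (u \<star> z)"
    by (simp add: UU_def AA_nat vcomp_tail[OF w2]) (simp add: AA_def laws)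
qed

lemma Ph_opmorphism:
  assumes [simp]: "z \<in> Mor K" "trg K z = X"
  shows "MS (f \<star> z) \<cdot> (s \<rhd> Ph z) \<cdot> Ph (t \<star> z) = Ph z \<cdot> (f \<rhd> MT z)"
    and "Ph z \<cdot> (f \<rhd> HT z) = HS (f \<star> z)"
proof -
  have a: "(f \<rhd> t \<rhd> g \<rhd> Ph z) \<cdot> (f \<rhd> t \<rhd> HF (t \<star> z)) = (f \<rhd> t \<rhd> PS (f \<star> z)) \<cdot> (f \<rhd> t \<rhd> t \<rhd> HF z)"
    using arg_cong[OF Ph_mate, of z "\<lambda>x. f \<rhd> t \<rhd> x"] by simp
  have p: "(f \<rhd> g \<rhd> MS (f \<star> z)) \<cdot> (f \<rhd> PS (s \<star> f \<star> z)) \<cdot> (f \<rhd> t \<rhd> PS (f \<star> z)) = (f \<rhd> PS (f \<star> z)) \<cdot> (f \<rhd> MT (g \<star> f \<star> z))"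
    using arg_cong[OF PS_mult, of "f \<star> z" "\<lambda>x. f \<rhd> x"] by simp
  have n: "(f \<rhd> MT (g \<star> f \<star> z)) \<cdot> (f \<rhd> t \<rhd> t \<rhd> HF z) = (f \<rhd> t \<rhd> HF z) \<cdot> (f \<rhd> MT z)"
    by (simp add: MT_nat flip: whisker_simps(2))
  have "MS (f \<star> z) \<cdot> (s \<rhd> Ph z) \<cdot> Ph (t \<star> z)
     = MS (f \<star> z) \<cdot> EF (s \<star> s \<star> f \<star> z) \<cdot> (f \<rhd> PS (s \<star> f \<star> z)) \<cdot> (f \<rhd> t \<rhd> PS (f \<star> z)) \<cdot> (f \<rhd> t \<rhd> t \<rhd> HF z)"
    by (simp add: whisker_Ph a)
  also have "\<dots> = EF (s \<star> f \<star> z) \<cdot> ((f \<rhd> g \<rhd> MS (f \<star> z)) \<cdot> (f \<rhd> PS (s \<star> f \<star> z)) \<cdot> (f \<rhd> t \<rhd> PS (f \<star> z))) \<cdot> (f \<rhd> t \<rhd> t \<rhd> HF z)"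
    by (simp add: EF_nat)
  also have "\<dots> = Ph z \<cdot> (f \<rhd> MT z)" unfolding p by (simp add: n Ph_def)
  finally show "MS (f \<star> z) \<cdot> (s \<rhd> Ph z) \<cdot> Ph (t \<star> z) = Ph z \<cdot> (f \<rhd> MT z)" .
  have h: "(f \<rhd> t \<rhd> HF z) \<cdot> (f \<rhd> HT z) = (f \<rhd> HT (g \<star> f \<star> z)) \<cdot> (f \<rhd> HF z)"
    by (simp add: HT_nat flip: whisker_simps(2))
  have k: "(f \<rhd> PS (f \<star> z)) \<cdot> (f \<rhd> HT (g \<star> f \<star> z)) = f \<rhd> g \<rhd> HS (f \<star> z)"
    by (simp add: PS_unit flip: whisker_simps(2))
  show "Ph z \<cdot> (f \<rhd> HT z) = HS (f \<star> z)"
    by (simp add: Ph_def h vcomp_tail[OF k] EF_nat laws)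
qed

lemma equations_hold: equations
  unfolding equations_def
proof (intro conjI allI impI; elim conjE)
  fix z assume [simp]: "z \<in> Mor K"
  { assume [simp]: "trg K z = A"
    show "MT (u \<star> z) \<cdot> (t \<rhd> Up z) \<cdot> Up (s \<star> z) = Up z \<cdot> (u \<rhd> MS z)"
      "Up z \<cdot> (u \<rhd> HS z) = HT (u \<star> z)"
      using Up_opmorphism[of z] by (simp_all add: Up_def)
    show "MS z \<cdot> Al (s \<star> z) = MS z \<cdot> (s \<rhd> Al z) \<cdot> Ph (u \<star> z) \<cdot> (f \<rhd> Up z)"
    proof -
      have k: "(f \<rhd> PJ z) \<cdot> (f \<rhd> UU z) = (f \<rhd> g \<rhd> MS z) \<cdot> (f \<rhd> AA (s \<star> z))"
        using whisker2[of "PJ z" "UU z" "(g \<rhd> MS z) \<cdot> AA (s \<star> z)" f] by (simp add: UU_def laws)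
      show ?thesis
        by (simp add: vcomp_tail3[OF counit_Ph] Up_def k) (simp add: EF_nat Al_def)
    qed
    show "HT (u \<star> z) = MT (u \<star> z) \<cdot> (t \<rhd> Up z) \<cdot> (t \<rhd> u \<rhd> Al z) \<cdot> Be (u \<star> z)"
      by (simp add: Up_def Al_def Be_mate vcomp_tail3[OF PI_from_UU]) (simp add: AA_def laws)
    show "MT (u \<star> z) \<cdot> (t \<rhd> Up z) \<cdot> (t \<rhd> u \<rhd> EF (s \<star> z)) \<cdot> Be (g \<star> s \<star> z) = PI z"
      (* the identity is the mate of the counit at s z *)
      using Be_mate[of "\<i> (g \<star> s \<star> z)" "s \<star> z"] by (simp add: Up_def PI_from_UU)
  }
  { assume [simp]: "trg K z = X"
    show "MS (f \<star> z) \<cdot> (s \<rhd> Ph z) \<cdot> Ph (t \<star> z) = Ph z \<cdot> (f \<rhd> MT z)"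
      "Ph z \<cdot> (f \<rhd> HT z) = HS (f \<star> z)"
      using Ph_opmorphism[of z] by simp_all
    show "MT (u \<star> f \<star> z) \<cdot> (t \<rhd> Be z)
       = MT (u \<star> f \<star> z) \<cdot> (t \<rhd> Up (f \<star> z)) \<cdot> (t \<rhd> u \<rhd> Ph z) \<cdot> Be (t \<star> z)"
    proof -
      have b: "(t \<rhd> u \<rhd> Ph z) \<cdot> Be (t \<star> z) = BB (s \<star> f \<star> z) \<cdot> PS (f \<star> z) \<cdot> (t \<rhd> HF z)"
        using Be_mate[of "PS (f \<star> z) \<cdot> (t \<rhd> HF z)" "s \<star> f \<star> z"] by (simp add: Ph_def)
      show ?thesis
        by (simp add: Up_def b vcomp_tail3[OF PI_from_UU]) (simp add: PS_def laws Be_def)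
    qed
    show "HS (f \<star> z) = MS (f \<star> z) \<cdot> (s \<rhd> Al (f \<star> z)) \<cdot> Ph (u \<star> f \<star> z) \<cdot> (f \<rhd> Be z)"
    proof -
      have k: "(f \<rhd> PJ (f \<star> z)) \<cdot> (f \<rhd> Be z) = (f \<rhd> g \<rhd> HS (f \<star> z)) \<cdot> (f \<rhd> HF z)"
        using whisker2[of "PJ (f \<star> z)" "Be z" "(g \<rhd> HS (f \<star> z)) \<cdot> HF z" f]
        by (simp add: Be_def BB_def laws)
      show ?thesis by (simp add: vcomp_tail3[OF counit_Ph] k EF_nat laws)
    qed
  }
qed

end

text \<open>
  Every constraint in the definitions of the adjunction and of its associated core acts by an identity.
\<close>

lemma extends_core_iff: 
  "extends_core K A s \<eta>\<^sub>s \<mu>\<^sub>s X t \<eta>\<^sub>t \<mu>\<^sub>t f g \<epsilon>\<^sub>f u \<pi> \<phi> \<upsilon>' \<alpha> \<beta> \<longleftrightarrow> equations"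
proof -
  note str = core_families kl_families
  have o1: "monad_opmorphism K A s \<eta>\<^sub>s \<mu>\<^sub>s X t \<eta>\<^sub>t \<mu>\<^sub>t u \<upsilon>' \<longleftrightarrow>
    (\<forall>z. z \<in> Mor K \<and> trg K z = A \<longrightarrow> MT (u \<star> z) \<cdot> (t \<rhd> Up z) \<cdot> Up (s \<star> z) = Up z \<cdot> (u \<rhd> MS z)) \<and>
    (\<forall>z. z \<in> Mor K \<and> trg K z = A \<longrightarrow> Up z \<cdot> (u \<rhd> HS z) = HT (u \<star> z))"
    by (rule monad_opmorphism_strict_iff[OF homs(3,4,5) HS MS HT MT Up])
  have o2: "monad_opmorphism K X t \<eta>\<^sub>t \<mu>\<^sub>t A s \<eta>\<^sub>s \<mu>\<^sub>s f \<phi> \<longleftrightarrow>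
    (\<forall>z. z \<in> Mor K \<and> trg K z = X \<longrightarrow> MS (f \<star> z) \<cdot> (s \<rhd> Ph z) \<cdot> Ph (t \<star> z) = Ph z \<cdot> (f \<rhd> MT z)) \<and>
    (\<forall>z. z \<in> Mor K \<and> trg K z = X \<longrightarrow> Ph z \<cdot> (f \<rhd> HT z) = HS (f \<star> z))"
    by (rule monad_opmorphism_strict_iff[OF homs(4,3,1) HT MT HS MS Ph])
  have c: "\<alpha> \<in> cells K (f \<star> u) s" "\<beta> \<in> cells K (\<one> X) (t \<star> u \<star> f)"
    by (simp_all add: cells_iff)
  have e1: "\<mu>\<^sub>s \<cdot> (\<alpha> \<lhd> s)
       = \<mu>\<^sub>s \<cdot> (s \<rhd> \<alpha>) \<cdot> \<a>[s, f, u] \<cdot> (\<phi> \<lhd> u) \<cdot> \<a>\<^sup>-[f, t, u] \<cdot> (f \<rhd> \<upsilon>') \<cdot> \<a>[f, u, s] \<longleftrightarrow>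
    (\<forall>z. z \<in> Mor K \<and> trg K z = A \<longrightarrow> MS z \<cdot> Al (s \<star> z) = MS z \<cdot> (s \<rhd> Al z) \<cdot> Ph (u \<star> z) \<cdot> (f \<rhd> Up z))"
    by (rule strict_eq_iff[where P="(Gen f \<bullet> Gen u) \<bullet> Gen s"]) (rule strict_rules str | simp)+
  have e2: "(\<mu>\<^sub>t \<lhd> (u \<star> f)) \<cdot> \<a>\<^sup>-[t, t, u \<star> f] \<cdot> (t \<rhd> \<beta>) \<cdot> \<r>\<^sup>-[t]
       = (\<mu>\<^sub>t \<lhd> (u \<star> f)) \<cdot> \<a>\<^sup>-[t, t, u \<star> f] \<cdot> (t \<rhd> \<a>[t, u, f]) \<cdot> (t \<rhd> (\<upsilon>' \<lhd> f))
         \<cdot> (t \<rhd> \<a>\<^sup>-[u, s, f]) \<cdot> (t \<rhd> u \<rhd> \<phi>) \<cdot> (t \<rhd> \<a>[u, f, t]) \<cdot> \<a>[t, u \<star> f, t]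
         \<cdot> (\<beta> \<lhd> t) \<cdot> \<l>\<^sup>-[t] \<longleftrightarrow>
    (\<forall>z. z \<in> Mor K \<and> trg K z = X \<longrightarrow> MT (u \<star> f \<star> z) \<cdot> (t \<rhd> Be z)
     = MT (u \<star> f \<star> z) \<cdot> (t \<rhd> Up (f \<star> z)) \<cdot> (t \<rhd> u \<rhd> Ph z) \<cdot> Be (t \<star> z))"
    by (rule strict_eq_iff[where P="Gen t"]) (rule strict_rules str | simp)+
  have e3: "(\<eta>\<^sub>s \<lhd> f) \<cdot> \<l>\<^sup>-[f]
       = (\<mu>\<^sub>s \<lhd> f) \<cdot> \<a>\<^sup>-[s, s, f] \<cdot> (s \<rhd> (\<alpha> \<lhd> f)) \<cdot> (s \<rhd> \<a>\<^sup>-[f, u, f]) \<cdot> \<a>[s, f, u \<star> f]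
         \<cdot> (\<phi> \<lhd> (u \<star> f)) \<cdot> \<a>\<^sup>-[f, t, u \<star> f] \<cdot> (f \<rhd> \<beta>) \<cdot> \<r>\<^sup>-[f] \<longleftrightarrow>
    (\<forall>z. z \<in> Mor K \<and> trg K z = X \<longrightarrow> HS (f \<star> z)
     = MS (f \<star> z) \<cdot> (s \<rhd> Al (f \<star> z)) \<cdot> Ph (u \<star> f \<star> z) \<cdot> (f \<rhd> Be z))"
    by (rule strict_eq_iff[where P="Gen f"]) (rule strict_rules str | simp)+
  have e4: "(\<eta>\<^sub>t \<lhd> u) \<cdot> \<l>\<^sup>-[u]
       = (\<mu>\<^sub>t \<lhd> u) \<cdot> \<a>\<^sup>-[t, t, u] \<cdot> (t \<rhd> \<upsilon>') \<cdot> (t \<rhd> u \<rhd> \<alpha>) \<cdot> (t \<rhd> \<a>[u, f, u])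
         \<cdot> \<a>[t, u \<star> f, u] \<cdot> (\<beta> \<lhd> u) \<cdot> \<l>\<^sup>-[u] \<longleftrightarrow>
    (\<forall>z. z \<in> Mor K \<and> trg K z = A \<longrightarrow> HT (u \<star> z)
     = MT (u \<star> z) \<cdot> (t \<rhd> Up z) \<cdot> (t \<rhd> u \<rhd> Al z) \<cdot> Be (u \<star> z))"
    by (rule strict_eq_iff[where P="Gen u"]) (rule strict_rules str | simp)+
  have e5: "associated_core K s t \<mu>\<^sub>t f g \<epsilon>\<^sub>f u \<upsilon>' \<beta> = \<pi> \<longleftrightarrow>
    (\<forall>z. z \<in> Mor K \<and> trg K z = A \<longrightarrow>
     MT (u \<star> z) \<cdot> (t \<rhd> Up z) \<cdot> (t \<rhd> u \<rhd> EF (s \<star> z)) \<cdot> Be (g \<star> s \<star> z) = PI z)"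
    unfolding associated_core_def
    by (rule strict_eq_iff[where P="Gen g \<bullet> Gen s"]) (rule strict_rules str | simp)+
  show ?thesis
    unfolding extends_core_def KL_adjunction_def equations_def using c
    by (simp only: o1 o2 e1 e2 e3 e4 e5 simp_thms conj_assoc)
qed

end

section \<open>From natural families back to cells\<close>

text \<open>
  Every cell has a family, so the hypotheses on a core in \<open>K\<close> provide one in strict form.
\<close>

lemma (in bicategory) strict_core_families:
  assumes mon_s: "monad K A s \<eta>\<^sub>s \<mu>\<^sub>s"
    and mon_t: "monad K X t \<eta>\<^sub>t \<mu>\<^sub>t"
    and adj: "adjunction K X A f g \<eta>\<^sub>f \<epsilon>\<^sub>f"
    and core: "adjunction_core K A s X t u g \<pi>"
    and \<beta>': "\<beta>' = \<pi> \<cdot> (g \<rhd> \<eta>\<^sub>s) \<cdot> \<r>\<^sup>-[g]"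
    and \<alpha>': "\<alpha>' = inv_cell K \<pi> \<cdot> (\<eta>\<^sub>t \<lhd> u) \<cdot> \<l>\<^sup>-[u]"
    and \<upsilon>: "\<upsilon> = \<pi> \<cdot> (g \<rhd> \<mu>\<^sub>s) \<cdot> \<a>[g, s, s] \<cdot> (\<alpha>' \<lhd> s)"
    and \<psi>: "\<psi> = inv_cell K \<pi> \<cdot> (\<mu>\<^sub>t \<lhd> u) \<cdot> \<a>\<^sup>-[t, t, u] \<cdot> (t \<rhd> \<beta>')"
  shows "strict_core K A X f g s t u \<eta>\<^sub>s \<mu>\<^sub>s \<eta>\<^sub>t \<mu>\<^sub>t \<eta>\<^sub>f \<epsilon>\<^sub>f \<pi> \<beta>' \<alpha>' \<upsilon> \<psi>
    (family (Unit A) (Gen s) \<eta>\<^sub>s) (family (Gen s \<bullet> Gen s) (Gen s) \<mu>\<^sub>s)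
    (family (Unit X) (Gen t) \<eta>\<^sub>t) (family (Gen t \<bullet> Gen t) (Gen t) \<mu>\<^sub>t)
    (family (Unit X) (Gen g \<bullet> Gen f) \<eta>\<^sub>f) (family (Gen f \<bullet> Gen g) (Unit A) \<epsilon>\<^sub>f)
    (family (Gen g \<bullet> Gen s) (Gen t \<bullet> Gen u) \<pi>)
    (family (Gen t \<bullet> Gen u) (Gen g \<bullet> Gen s) (inv_cell K \<pi>))
    (family (Gen g) (Gen t \<bullet> Gen u) \<beta>') (family (Gen u) (Gen g \<bullet> Gen s) \<alpha>')
    (family (Gen u \<bullet> Gen s) (Gen t \<bullet> Gen u) \<upsilon>) (family (Gen t \<bullet> Gen g) (Gen g \<bullet> Gen s) \<psi>)"
    (is "strict_core _ _ _ _ _ _ _ _ _ _ _ _ _ _ _ _ _ _ _ ?HS ?MS ?HT ?MT ?HF ?EF ?PI ?PJ ?BB ?AA ?UU ?PS")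
proof -
  have [simp]: "A \<in> Obj K" "X \<in> Obj K"
    "f \<in> Mor K" "src K f = X" "trg K f = A" "g \<in> Mor K" "src K g = A" "trg K g = X"
    "s \<in> Mor K" "src K s = A" "trg K s = A" "t \<in> Mor K" "src K t = X" "trg K t = X"
    "u \<in> Mor K" "src K u = A" "trg K u = X"
    using assms(1-4) by (auto simp: monad_def adjunction_def adjunction_core_def hom_iff)
  have [simp]: "\<eta>\<^sub>s \<in> Cell K" "vdom K \<eta>\<^sub>s = \<one> A" "vcod K \<eta>\<^sub>s = s"
    "\<mu>\<^sub>s \<in> Cell K" "vdom K \<mu>\<^sub>s = s \<star> s" "vcod K \<mu>\<^sub>s = s"
    "\<eta>\<^sub>t \<in> Cell K" "vdom K \<eta>\<^sub>t = \<one> X" "vcod K \<eta>\<^sub>t = t"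
    "\<mu>\<^sub>t \<in> Cell K" "vdom K \<mu>\<^sub>t = t \<star> t" "vcod K \<mu>\<^sub>t = t"
    "\<eta>\<^sub>f \<in> Cell K" "vdom K \<eta>\<^sub>f = \<one> X" "vcod K \<eta>\<^sub>f = g \<star> f"
    "\<epsilon>\<^sub>f \<in> Cell K" "vdom K \<epsilon>\<^sub>f = f \<star> g" "vcod K \<epsilon>\<^sub>f = \<one> A"
    "\<pi> \<in> Cell K" "vdom K \<pi> = g \<star> s" "vcod K \<pi> = t \<star> u" "invertible K \<pi>"
    using assms(1-4) by (auto simp: monad_def adjunction_def adjunction_core_def cells_iff)
  have [simp]: "\<beta>' \<in> Cell K" "vdom K \<beta>' = g" "vcod K \<beta>' = t \<star> u"
    "\<alpha>' \<in> Cell K" "vdom K \<alpha>' = u" "vcod K \<alpha>' = g \<star> s"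
    unfolding \<beta>' \<alpha>' by simp_all
  have [simp]: "\<upsilon> \<in> Cell K" "vdom K \<upsilon> = u \<star> s" "vcod K \<upsilon> = t \<star> u"
    "\<psi> \<in> Cell K" "vdom K \<psi> = t \<star> g" "vcod K \<psi> = g \<star> s"
    unfolding \<upsilon> \<psi> by simp_all
  have HS: "strictifies (Unit A) (Gen s) \<eta>\<^sub>s ?HS"
    and MS: "strictifies (Gen s \<bullet> Gen s) (Gen s) \<mu>\<^sub>s ?MS"
    and HT: "strictifies (Unit X) (Gen t) \<eta>\<^sub>t ?HT"
    and MT: "strictifies (Gen t \<bullet> Gen t) (Gen t) \<mu>\<^sub>t ?MT"
    and HF: "strictifies (Unit X) (Gen g \<bullet> Gen f) \<eta>\<^sub>f ?HF"
    and EF: "strictifies (Gen f \<bullet> Gen g) (Unit A) \<epsilon>\<^sub>f ?EF"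
    and PI: "strictifies (Gen g \<bullet> Gen s) (Gen t \<bullet> Gen u) \<pi> ?PI"
    and PJ: "strictifies (Gen t \<bullet> Gen u) (Gen g \<bullet> Gen s) (inv_cell K \<pi>) ?PJ"
    and BB: "strictifies (Gen g) (Gen t \<bullet> Gen u) \<beta>' ?BB"
    and AA: "strictifies (Gen u) (Gen g \<bullet> Gen s) \<alpha>' ?AA"
    and UU: "strictifies (Gen u \<bullet> Gen s) (Gen t \<bullet> Gen u) \<upsilon> ?UU"
    and PS: "strictifies (Gen t \<bullet> Gen g) (Gen g \<bullet> Gen s) \<psi> ?PS"
    by (rule strict_family; simp add: cells_iff)+
  note str = HS MS HT MT HF EF PI PJ BB AA UU PS
  note typing [simp] = str[THEN strictifiesD(8), simplified] str[THEN strictifiesD(9), simplified]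
    str[THEN strictifiesD(10), simplified]
  have homs: "s \<in> hom K A A" "t \<in> hom K X X" by (simp_all add: hom_iff)
  have ms: "\<forall>z. z \<in> Mor K \<and> trg K z = A \<longrightarrow> ?MS z \<cdot> ?MS (s \<star> z) = ?MS z \<cdot> (s \<rhd> ?MS z)"
      "\<forall>z. z \<in> Mor K \<and> trg K z = A \<longrightarrow> ?MS z \<cdot> ?HS (s \<star> z) = \<i> (s \<star> z)"
      "\<forall>z. z \<in> Mor K \<and> trg K z = A \<longrightarrow> ?MS z \<cdot> (s \<rhd> ?HS z) = \<i> (s \<star> z)"
    using mon_s monad_strict_iff[OF _ homs(1) HS MS] by simp_all
  have mt: "\<forall>z. z \<in> Mor K \<and> trg K z = X \<longrightarrow> ?MT z \<cdot> ?MT (t \<star> z) = ?MT z \<cdot> (t \<rhd> ?MT z)"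
      "\<forall>z. z \<in> Mor K \<and> trg K z = X \<longrightarrow> ?MT z \<cdot> ?HT (t \<star> z) = \<i> (t \<star> z)"
      "\<forall>z. z \<in> Mor K \<and> trg K z = X \<longrightarrow> ?MT z \<cdot> (t \<rhd> ?HT z) = \<i> (t \<star> z)"
    using mon_t monad_strict_iff[OF _ homs(2) HT MT] by simp_all
  have a1: "\<l>[f] \<cdot> (\<epsilon>\<^sub>f \<lhd> f) \<cdot> \<a>\<^sup>-[f, g, f] \<cdot> (f \<rhd> \<eta>\<^sub>f) \<cdot> \<r>\<^sup>-[f] = \<i> f \<longleftrightarrow>
      (\<forall>z. z \<in> Mor K \<and> trg K z = X \<longrightarrow> ?EF (f \<star> z) \<cdot> (f \<rhd> ?HF z) = \<i> (f \<star> z))"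
    by (rule strict_eq_iff[where P="Gen f"]) (rule strict_rules strict_idc str | simp)+
  have a2: "\<r>[g] \<cdot> (g \<rhd> \<epsilon>\<^sub>f) \<cdot> \<a>[g, f, g] \<cdot> (\<eta>\<^sub>f \<lhd> g) \<cdot> \<l>\<^sup>-[g] = \<i> g \<longleftrightarrow>
      (\<forall>z. z \<in> Mor K \<and> trg K z = A \<longrightarrow> (g \<rhd> ?EF z) \<cdot> ?HF (g \<star> z) = \<i> (g \<star> z))"
    by (rule strict_eq_iff[where P="Gen g"]) (rule strict_rules strict_idc str | simp)+
  have p1: "inv_cell K \<pi> \<cdot> \<pi> = \<i> (g \<star> s) \<longleftrightarrow>
      (\<forall>z. z \<in> Mor K \<and> trg K z = A \<longrightarrow> ?PJ z \<cdot> ?PI z = \<i> (g \<star> s \<star> z))"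
    by (rule strict_eq_iff[where P="Gen g \<bullet> Gen s"]) (rule strict_vcomp strict_idc str | simp)+
  have p2: "\<pi> \<cdot> inv_cell K \<pi> = \<i> (t \<star> u) \<longleftrightarrow>
      (\<forall>z. z \<in> Mor K \<and> trg K z = A \<longrightarrow> ?PI z \<cdot> ?PJ z = \<i> (t \<star> u \<star> z))"
    by (rule strict_eq_iff[where P="Gen t \<bullet> Gen u"]) (rule strict_vcomp strict_idc str | simp)+
  have b: "\<beta>' = \<pi> \<cdot> (g \<rhd> \<eta>\<^sub>s) \<cdot> \<r>\<^sup>-[g] \<longleftrightarrow>
      (\<forall>z. z \<in> Mor K \<and> trg K z = A \<longrightarrow> ?BB z = ?PI z \<cdot> (g \<rhd> ?HS z))"
    by (rule strict_eq_iff[where P="Gen g"]) (rule strict_rules str | simp)+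
  have a: "\<alpha>' = inv_cell K \<pi> \<cdot> (\<eta>\<^sub>t \<lhd> u) \<cdot> \<l>\<^sup>-[u] \<longleftrightarrow>
      (\<forall>z. z \<in> Mor K \<and> trg K z = A \<longrightarrow> ?AA z = ?PJ z \<cdot> ?HT (u \<star> z))"
    by (rule strict_eq_iff[where P="Gen u"]) (rule strict_rules str | simp)+
  have v: "\<upsilon> = \<pi> \<cdot> (g \<rhd> \<mu>\<^sub>s) \<cdot> \<a>[g, s, s] \<cdot> (\<alpha>' \<lhd> s) \<longleftrightarrow>
      (\<forall>z. z \<in> Mor K \<and> trg K z = A \<longrightarrow> ?UU z = ?PI z \<cdot> (g \<rhd> ?MS z) \<cdot> ?AA (s \<star> z))"
    by (rule strict_eq_iff[where P="Gen u \<bullet> Gen s"]) (rule strict_rules str | simp)+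
  have p: "\<psi> = inv_cell K \<pi> \<cdot> (\<mu>\<^sub>t \<lhd> u) \<cdot> \<a>\<^sup>-[t, t, u] \<cdot> (t \<rhd> \<beta>') \<longleftrightarrow>
      (\<forall>z. z \<in> Mor K \<and> trg K z = A \<longrightarrow> ?PS z = ?PJ z \<cdot> ?MT (u \<star> z) \<cdot> (t \<rhd> ?BB z))"
    by (rule strict_eq_iff[where P="Gen t \<bullet> Gen g"]) (rule strict_rules str | simp)+
  have adj': "\<l>[f] \<cdot> (\<epsilon>\<^sub>f \<lhd> f) \<cdot> \<a>\<^sup>-[f, g, f] \<cdot> (f \<rhd> \<eta>\<^sub>f) \<cdot> \<r>\<^sup>-[f] = \<i> f"
      "\<r>[g] \<cdot> (g \<rhd> \<epsilon>\<^sub>f) \<cdot> \<a>[g, f, g] \<cdot> (\<eta>\<^sub>f \<lhd> g) \<cdot> \<l>\<^sup>-[g] = \<i> g"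
    using adj by (simp_all add: adjunction_def)
  have inv: "inv_cell K \<pi> \<cdot> \<pi> = \<i> (g \<star> s)" "\<pi> \<cdot> inv_cell K \<pi> = \<i> (t \<star> u)" by simp_all
  note equations = ms mt a1[THEN iffD1, OF adj'(1)] a2[THEN iffD1, OF adj'(2)]
    p1[THEN iffD1, OF inv(1)] p2[THEN iffD1, OF inv(2)] b[THEN iffD1, OF \<beta>'] a[THEN iffD1, OF \<alpha>']
    v[THEN iffD1, OF \<upsilon>] p[THEN iffD1, OF \<psi>]
  show ?thesis
    by unfold_locales (rule str | simp add: hom_iff equations[rule_format])+
qed

context strict_core
begin

lemma cond_I_iff: 
  "(\<mu>\<^sub>t \<lhd> u) \<cdot> \<a>\<^sup>-[t, t, u] \<cdot> (t \<rhd> \<upsilon>) \<cdot> \<a>[t, u, s] \<cdot> (\<pi> \<lhd> s) = \<pi> \<cdot> (g \<rhd> \<mu>\<^sub>s) \<cdot> \<a>[g, s, s] \<longleftrightarrow> cond_I"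
  unfolding cond_I_def
  by (rule strict_eq_iff[where P="(Gen g \<bullet> Gen s) \<bullet> Gen s"]) (rule strict_rules core_families | simp)+

lemma cond_II_iff: 
  assumes "invertible K \<pi>"
  shows "(g \<rhd> \<mu>\<^sub>s) \<cdot> \<a>[g, s, s] \<cdot> (\<psi> \<lhd> s) \<cdot> \<a>\<^sup>-[t, g, s] \<cdot> (t \<rhd> inv_cell K \<pi>)
              = inv_cell K \<pi> \<cdot> (\<mu>\<^sub>t \<lhd> u) \<cdot> \<a>\<^sup>-[t, t, u] \<longleftrightarrow> cond_II"
  unfolding cond_II_def
  by (rule strict_eq_iff[where P="Gen t \<bullet> Gen t \<bullet> Gen u"]) (rule strict_rules core_families | simp)+

lemma extends_core_kl_data:
  assumes "extends_core K A s \<eta>\<^sub>s \<mu>\<^sub>s X t \<eta>\<^sub>t \<mu>\<^sub>t f g \<epsilon>\<^sub>f u \<pi> \<phi> \<upsilon>' \<alpha> \<beta>"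
  shows "kl_data K A X f g s t u \<eta>\<^sub>s \<mu>\<^sub>s \<eta>\<^sub>t \<mu>\<^sub>t \<eta>\<^sub>f \<epsilon>\<^sub>f \<pi> \<beta>' \<alpha>' \<upsilon> \<psi> HS MS HT MT HF EF PI PJ BB AA UU PS
    \<phi> \<upsilon>' \<alpha> \<beta> (family (Gen f \<bullet> Gen t) (Gen s \<bullet> Gen f) \<phi>) (family (Gen u \<bullet> Gen s) (Gen t \<bullet> Gen u) \<upsilon>')
    (family (Gen f \<bullet> Gen u) (Gen s) \<alpha>) (family (Unit X) (Gen t \<bullet> Gen u \<bullet> Gen f) \<beta>)"
  using assms
  by unfold_locales (auto intro!: strict_family simp: extends_core_def KL_adjunction_def monad_opmorphism_def)

text \<open>
  The mates are written out as cells of \<open>K\<close>, so that equal families yield equal cells.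
\<close>

lemma extends_core_determined:
  assumes ext: "extends_core K A s \<eta>\<^sub>s \<mu>\<^sub>s X t \<eta>\<^sub>t \<mu>\<^sub>t f g \<epsilon>\<^sub>f u \<pi> \<phi> \<upsilon>' \<alpha> \<beta>"
  shows "cond_I" and "\<upsilon>' = \<upsilon>"
    and "\<alpha> = \<l>[s] \<cdot> (\<epsilon>\<^sub>f \<lhd> s) \<cdot> \<a>\<^sup>-[f, g, s] \<cdot> (f \<rhd> \<alpha>')"
    and "\<beta> = \<a>[t, u, f] \<cdot> (\<beta>' \<lhd> f) \<cdot> \<eta>\<^sub>f"
    and "\<phi> = (\<l>[s] \<lhd> f) \<cdot> ((\<epsilon>\<^sub>f \<lhd> s) \<lhd> f) \<cdot> (\<a>\<^sup>-[f, g, s] \<lhd> f) \<cdot> ((f \<rhd> \<psi>) \<lhd> f) \<cdot> (\<a>[f, t, g] \<lhd> f)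
      \<cdot> \<a>\<^sup>-[f \<star> t, g, f] \<cdot> ((f \<star> t) \<rhd> \<eta>\<^sub>f) \<cdot> \<r>\<^sup>-[f \<star> t]"
proof -
  interpret kl_data K A X f g s t u \<eta>\<^sub>s \<mu>\<^sub>s \<eta>\<^sub>t \<mu>\<^sub>t \<eta>\<^sub>f \<epsilon>\<^sub>f \<pi> \<beta>' \<alpha>' \<upsilon> \<psi> HS MS HT MT HF EF PI PJ BB AA UU PS
    \<phi> \<upsilon>' \<alpha> \<beta> "family (Gen f \<bullet> Gen t) (Gen s \<bullet> Gen f) \<phi>" "family (Gen u \<bullet> Gen s) (Gen t \<bullet> Gen u) \<upsilon>'"
    "family (Gen f \<bullet> Gen u) (Gen s) \<alpha>" "family (Unit X) (Gen t \<bullet> Gen u \<bullet> Gen f) \<beta>"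
    by (rule extends_core_kl_data[OF ext])
  have eqs: equations using ext extends_core_iff by simp
  note str = core_families kl_families
  show cond_I by (rule equations_cond_I[OF eqs])
  show "\<upsilon>' = \<upsilon>"
    by (rule strict_eqI[OF Up UU]) (simp add: Up_eq_UU[OF eqs])
  have "\<alpha> = \<l>[s] \<cdot> (\<epsilon>\<^sub>f \<lhd> s) \<cdot> \<a>\<^sup>-[f, g, s] \<cdot> (f \<rhd> \<alpha>') \<longleftrightarrow>
    (\<forall>z. z \<in> Mor K \<and> trg K z = A \<longrightarrow> family (Gen f \<bullet> Gen u) (Gen s) \<alpha> z = EF (s \<star> z) \<cdot> (f \<rhd> AA z))"
    by (rule strict_eq_iff[where P="Gen f \<bullet> Gen u"]) (rule strict_rules str | simp)+
  then show "\<alpha> = \<l>[s] \<cdot> (\<epsilon>\<^sub>f \<lhd> s) \<cdot> \<a>\<^sup>-[f, g, s] \<cdot> (f \<rhd> \<alpha>')"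
    using Al_determined[OF eqs] by simp
  have "\<beta> = \<a>[t, u, f] \<cdot> (\<beta>' \<lhd> f) \<cdot> \<eta>\<^sub>f \<longleftrightarrow>
    (\<forall>z. z \<in> Mor K \<and> trg K z = X \<longrightarrow> family (Unit X) (Gen t \<bullet> Gen u \<bullet> Gen f) \<beta> z = BB (f \<star> z) \<cdot> HF z)"
    by (rule strict_eq_iff[where P="Unit X"]) (rule strict_rules str | simp)+
  then show "\<beta> = \<a>[t, u, f] \<cdot> (\<beta>' \<lhd> f) \<cdot> \<eta>\<^sub>f"
    using Be_determined[OF eqs] by simp
  have "\<phi> = (\<l>[s] \<lhd> f) \<cdot> ((\<epsilon>\<^sub>f \<lhd> s) \<lhd> f) \<cdot> (\<a>\<^sup>-[f, g, s] \<lhd> f) \<cdot> ((f \<rhd> \<psi>) \<lhd> f) \<cdot> (\<a>[f, t, g] \<lhd> f)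
      \<cdot> \<a>\<^sup>-[f \<star> t, g, f] \<cdot> ((f \<star> t) \<rhd> \<eta>\<^sub>f) \<cdot> \<r>\<^sup>-[f \<star> t] \<longleftrightarrow>
    (\<forall>z. z \<in> Mor K \<and> trg K z = X \<longrightarrow> family (Gen f \<bullet> Gen t) (Gen s \<bullet> Gen f) \<phi> z =
      EF (s \<star> f \<star> z) \<cdot> (f \<rhd> PS (f \<star> z)) \<cdot> (f \<rhd> t \<rhd> HF z))"
    by (rule strict_eq_iff[where P="Gen f \<bullet> Gen t"]) (rule strict_rules str | simp)+
  then show "\<phi> = (\<l>[s] \<lhd> f) \<cdot> ((\<epsilon>\<^sub>f \<lhd> s) \<lhd> f) \<cdot> (\<a>\<^sup>-[f, g, s] \<lhd> f) \<cdot> ((f \<rhd> \<psi>) \<lhd> f) \<cdot> (\<a>[f, t, g] \<lhd> f)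
      \<cdot> \<a>\<^sup>-[f \<star> t, g, f] \<cdot> ((f \<star> t) \<rhd> \<eta>\<^sub>f) \<cdot> \<r>\<^sup>-[f \<star> t]"
    using Ph_determined[OF eqs] by simp
qed

lemma extends_core_exists:
  assumes I: cond_I and II: cond_II
  shows "\<exists>\<phi> \<upsilon>' \<alpha> \<beta>. extends_core K A s \<eta>\<^sub>s \<mu>\<^sub>s X t \<eta>\<^sub>t \<mu>\<^sub>t f g \<epsilon>\<^sub>f u \<pi> \<phi> \<upsilon>' \<alpha> \<beta>"
proof -
  let ?\<alpha> = "\<l>[s] \<cdot> (\<epsilon>\<^sub>f \<lhd> s) \<cdot> \<a>\<^sup>-[f, g, s] \<cdot> (f \<rhd> \<alpha>')"
  let ?\<beta> = "\<a>[t, u, f] \<cdot> (\<beta>' \<lhd> f) \<cdot> \<eta>\<^sub>f"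
  let ?\<phi> = "(\<l>[s] \<lhd> f) \<cdot> ((\<epsilon>\<^sub>f \<lhd> s) \<lhd> f) \<cdot> (\<a>\<^sup>-[f, g, s] \<lhd> f) \<cdot> ((f \<rhd> \<psi>) \<lhd> f) \<cdot> (\<a>[f, t, g] \<lhd> f)
      \<cdot> \<a>\<^sup>-[f \<star> t, g, f] \<cdot> ((f \<star> t) \<rhd> \<eta>\<^sub>f) \<cdot> \<r>\<^sup>-[f \<star> t]"
  let ?Al = "\<lambda>z. EF (s \<star> z) \<cdot> (f \<rhd> AA z)" and ?Be = "\<lambda>z. BB (f \<star> z) \<cdot> HF z"
  let ?Ph = "\<lambda>z. EF (s \<star> f \<star> z) \<cdot> (f \<rhd> PS (f \<star> z)) \<cdot> (f \<rhd> t \<rhd> HF z)"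
  have Al: "strictifies (Gen f \<bullet> Gen u) (Gen s) ?\<alpha> ?Al"
    by (rule strict_cong) (rule strict_rules core_families | simp)+
  have Be: "strictifies (Unit X) (Gen t \<bullet> Gen u \<bullet> Gen f) ?\<beta> ?Be"
    by (rule strict_cong) (rule strict_rules core_families | simp)+
  have Ph: "strictifies (Gen f \<bullet> Gen t) (Gen s \<bullet> Gen f) ?\<phi> ?Ph"
    by (rule strict_cong) (rule strict_rules core_families | simp)+
  interpret kl_data K A X f g s t u \<eta>\<^sub>s \<mu>\<^sub>s \<eta>\<^sub>t \<mu>\<^sub>t \<eta>\<^sub>f \<epsilon>\<^sub>f \<pi> \<beta>' \<alpha>' \<upsilon> \<psi> HS MS HT MT HF EF PI PJ BB AA UU PS
    ?\<phi> \<upsilon> ?\<alpha> ?\<beta> ?Ph UU ?Al ?Be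
    by unfold_locales (rule Ph UU Al Be)+
  have equations by (rule equations_hold[OF I II]) simp_all
  then show ?thesis using extends_core_iff by blast
qed

lemma core_extension:
  assumes inv: "invertible K \<pi>"
  shows "((\<exists>\<phi> \<upsilon>' \<alpha> \<beta>. extends_core K A s \<eta>\<^sub>s \<mu>\<^sub>s X t \<eta>\<^sub>t \<mu>\<^sub>t f g \<epsilon>\<^sub>f u \<pi> \<phi> \<upsilon>' \<alpha> \<beta>) \<longleftrightarrow>
            (\<mu>\<^sub>t \<lhd> u) \<cdot> \<a>\<^sup>-[t, t, u] \<cdot> (t \<rhd> \<upsilon>) \<cdot> \<a>[t, u, s] \<cdot> (\<pi> \<lhd> s)
              = \<pi> \<cdot> (g \<rhd> \<mu>\<^sub>s) \<cdot> \<a>[g, s, s] \<or>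
            (g \<rhd> \<mu>\<^sub>s) \<cdot> \<a>[g, s, s] \<cdot> (\<psi> \<lhd> s) \<cdot> \<a>\<^sup>-[t, g, s] \<cdot> (t \<rhd> inv_cell K \<pi>)
              = inv_cell K \<pi> \<cdot> (\<mu>\<^sub>t \<lhd> u) \<cdot> \<a>\<^sup>-[t, t, u]) \<and>
         (\<forall>\<phi> \<upsilon>' \<alpha> \<beta>.
            extends_core K A s \<eta>\<^sub>s \<mu>\<^sub>s X t \<eta>\<^sub>t \<mu>\<^sub>t f g \<epsilon>\<^sub>f u \<pi> \<phi> \<upsilon>' \<alpha> \<beta> \<longrightarrow> \<upsilon>' = \<upsilon>) \<and>
         (\<forall>\<phi>\<^sub>1 \<upsilon>\<^sub>1 \<alpha>\<^sub>1 \<beta>\<^sub>1 \<phi>\<^sub>2 \<upsilon>\<^sub>2 \<alpha>\<^sub>2 \<beta>\<^sub>2.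
            extends_core K A s \<eta>\<^sub>s \<mu>\<^sub>s X t \<eta>\<^sub>t \<mu>\<^sub>t f g \<epsilon>\<^sub>f u \<pi> \<phi>\<^sub>1 \<upsilon>\<^sub>1 \<alpha>\<^sub>1 \<beta>\<^sub>1 \<longrightarrow>
            extends_core K A s \<eta>\<^sub>s \<mu>\<^sub>s X t \<eta>\<^sub>t \<mu>\<^sub>t f g \<epsilon>\<^sub>f u \<pi> \<phi>\<^sub>2 \<upsilon>\<^sub>2 \<alpha>\<^sub>2 \<beta>\<^sub>2 \<longrightarrow>
            (\<phi>\<^sub>1, \<upsilon>\<^sub>1, \<alpha>\<^sub>1, \<beta>\<^sub>1) = (\<phi>\<^sub>2, \<upsilon>\<^sub>2, \<alpha>\<^sub>2, \<beta>\<^sub>2))"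
proof (unfold cond_I_iff cond_II_iff[OF inv], intro conjI iffI allI impI)
  assume "\<exists>\<phi> \<upsilon>' \<alpha> \<beta>. extends_core K A s \<eta>\<^sub>s \<mu>\<^sub>s X t \<eta>\<^sub>t \<mu>\<^sub>t f g \<epsilon>\<^sub>f u \<pi> \<phi> \<upsilon>' \<alpha> \<beta>"
  then show "cond_I \<or> cond_II" using extends_core_determined(1) by blast
next
  assume "cond_I \<or> cond_II"
  then have bimodule using cond_I_bimodule cond_II_bimodule by blast
  then show "\<exists>\<phi> \<upsilon>' \<alpha> \<beta>. extends_core K A s \<eta>\<^sub>s \<mu>\<^sub>s X t \<eta>\<^sub>t \<mu>\<^sub>t f g \<epsilon>\<^sub>f u \<pi> \<phi> \<upsilon>' \<alpha> \<beta>"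
    by (intro extends_core_exists bimodule_cond_I bimodule_cond_II)
next
  fix \<phi> \<upsilon>' \<alpha> \<beta>
  assume "extends_core K A s \<eta>\<^sub>s \<mu>\<^sub>s X t \<eta>\<^sub>t \<mu>\<^sub>t f g \<epsilon>\<^sub>f u \<pi> \<phi> \<upsilon>' \<alpha> \<beta>"
  then show "\<upsilon>' = \<upsilon>" by (rule extends_core_determined(2))
next
  fix \<phi>\<^sub>1 \<upsilon>\<^sub>1 \<alpha>\<^sub>1 \<beta>\<^sub>1 \<phi>\<^sub>2 \<upsilon>\<^sub>2 \<alpha>\<^sub>2 \<beta>\<^sub>2
  assume 1: "extends_core K A s \<eta>\<^sub>s \<mu>\<^sub>s X t \<eta>\<^sub>t \<mu>\<^sub>t f g \<epsilon>\<^sub>f u \<pi> \<phi>\<^sub>1 \<upsilon>\<^sub>1 \<alpha>\<^sub>1 \<beta>\<^sub>1"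
    and 2: "extends_core K A s \<eta>\<^sub>s \<mu>\<^sub>s X t \<eta>\<^sub>t \<mu>\<^sub>t f g \<epsilon>\<^sub>f u \<pi> \<phi>\<^sub>2 \<upsilon>\<^sub>2 \<alpha>\<^sub>2 \<beta>\<^sub>2"
  show "(\<phi>\<^sub>1, \<upsilon>\<^sub>1, \<alpha>\<^sub>1, \<beta>\<^sub>1) = (\<phi>\<^sub>2, \<upsilon>\<^sub>2, \<alpha>\<^sub>2, \<beta>\<^sub>2)"
    unfolding extends_core_determined(2-5)[OF 1] extends_core_determined(2-5)[OF 2] ..
qed

end

theorem corollary7:
  fixes K :: "('o, 'm, 'c) bicat" (structure)
  assumes "bicategory K"
    and "monad K A s \<eta>\<^sub>s \<mu>\<^sub>s"
    and "monad K X t \<eta>\<^sub>t \<mu>\<^sub>t"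
    and "adjunction K X A f g \<eta>\<^sub>f \<epsilon>\<^sub>f"
    and "adjunction_core K A s X t u g \<pi>"
    and "\<beta>' = \<pi> \<cdot> (g \<rhd> \<eta>\<^sub>s) \<cdot> \<r>\<^sup>-[g]"
    and "\<alpha>' = inv_cell K \<pi> \<cdot> (\<eta>\<^sub>t \<lhd> u) \<cdot> \<l>\<^sup>-[u]"
    and "\<upsilon> = \<pi> \<cdot> (g \<rhd> \<mu>\<^sub>s) \<cdot> \<a>[g, s, s] \<cdot> (\<alpha>' \<lhd> s)"
    and "\<psi> = inv_cell K \<pi> \<cdot> (\<mu>\<^sub>t \<lhd> u) \<cdot> \<a>\<^sup>-[t, t, u] \<cdot> (t \<rhd> \<beta>')"
  shows "((\<exists>\<phi> \<upsilon>' \<alpha> \<beta>. extends_core K A s \<eta>\<^sub>s \<mu>\<^sub>s X t \<eta>\<^sub>t \<mu>\<^sub>t f g \<epsilon>\<^sub>f u \<pi> \<phi> \<upsilon>' \<alpha> \<beta>) \<longleftrightarrow>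
            (\<mu>\<^sub>t \<lhd> u) \<cdot> \<a>\<^sup>-[t, t, u] \<cdot> (t \<rhd> \<upsilon>) \<cdot> \<a>[t, u, s] \<cdot> (\<pi> \<lhd> s)
              = \<pi> \<cdot> (g \<rhd> \<mu>\<^sub>s) \<cdot> \<a>[g, s, s] \<or>
            (g \<rhd> \<mu>\<^sub>s) \<cdot> \<a>[g, s, s] \<cdot> (\<psi> \<lhd> s) \<cdot> \<a>\<^sup>-[t, g, s] \<cdot> (t \<rhd> inv_cell K \<pi>)
              = inv_cell K \<pi> \<cdot> (\<mu>\<^sub>t \<lhd> u) \<cdot> \<a>\<^sup>-[t, t, u]) \<and>
         (\<forall>\<phi> \<upsilon>' \<alpha> \<beta>.
            extends_core K A s \<eta>\<^sub>s \<mu>\<^sub>s X t \<eta>\<^sub>t \<mu>\<^sub>t f g \<epsilon>\<^sub>f u \<pi> \<phi> \<upsilon>' \<alpha> \<beta> \<longrightarrow> \<upsilon>' = \<upsilon>) \<and>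
         (\<forall>\<phi>\<^sub>1 \<upsilon>\<^sub>1 \<alpha>\<^sub>1 \<beta>\<^sub>1 \<phi>\<^sub>2 \<upsilon>\<^sub>2 \<alpha>\<^sub>2 \<beta>\<^sub>2.
            extends_core K A s \<eta>\<^sub>s \<mu>\<^sub>s X t \<eta>\<^sub>t \<mu>\<^sub>t f g \<epsilon>\<^sub>f u \<pi> \<phi>\<^sub>1 \<upsilon>\<^sub>1 \<alpha>\<^sub>1 \<beta>\<^sub>1 \<longrightarrow>
            extends_core K A s \<eta>\<^sub>s \<mu>\<^sub>s X t \<eta>\<^sub>t \<mu>\<^sub>t f g \<epsilon>\<^sub>f u \<pi> \<phi>\<^sub>2 \<upsilon>\<^sub>2 \<alpha>\<^sub>2 \<beta>\<^sub>2 \<longrightarrow>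
            (\<phi>\<^sub>1, \<upsilon>\<^sub>1, \<alpha>\<^sub>1, \<beta>\<^sub>1) = (\<phi>\<^sub>2, \<upsilon>\<^sub>2, \<alpha>\<^sub>2, \<beta>\<^sub>2))"
proof -
  have "invertible K \<pi>" using assms(5) by (simp add: adjunction_core_def)
  then show ?thesis
    by (rule strict_core.core_extension[OF bicategory.strict_core_families[OF assms]])
qed

end
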